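(* Assume a PCA on $\Omega_S=\{-1,+1\}^{\mathbb{Z}^d}$ with transition operator $P$ has contraction speed $(\psi_n)_{n\in\mathbb{N}}$, is local with propagation speed $a\in\mathbb{N}$, and has a stationary translation-invariant probability measure $\mu$ which satisfies $\mathrm{GCB}(C)$ for some $C>0$. Assume additionally that $\mu$ has finite energy, i.e. there exists $\rho>0$ such that $$\mu(\sigma_\Lambda)\ge e^{-\rho|\Lambda|}\qquad\text{for all }\sigma\in\Omega_S,\ \Lambda\Subset\mathbb{Z}^d .$$ Then, for every probability measure $\nu$ on $\Omega_S$ and all $n,k\in\mathbb{N}$, $$D_{\infty,C_n}^2(\nu P^k,\mu)\le 2C\,s_{C_{n+ak}}(\nu|\mu)\,\|\psi_k\|_2^2$$ and $$D_{2,C_n}^2(\nu P^k,\mu)\le 2C\,s_{C_{n+ak}}(\nu|\mu)\,\|\psi_k\|_1^2 .$$ As a consequence, for all $n,k\in\mathbb{N}$, $$D_{\infty,C_n}^2(\nu P^k,\mu)\le 2C\rho\,|C_{n+ak}|\,\|\psi_k\|_2^2 .$$ If $\nu$ is a translation-invariant probability measure, then for all $k\in\mathbb{N}$ $$\bar d(\nu P^k,\mu)^2\le 2C\rho\,\|\psi_k\|_1^2 .$$ As a consequence, if $\|\psi_k\|_1\to0$ as $k\to\infty$, then $\nu P^k\to\mu$ in $\bar d$-distance.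
   Context: $\mathbb{N}=\{0,1,2,\dots\}$. $\Lambda\Subset\mathbb{Z}^d$ means $\Lambda$ is a finite subset of $\mathbb{Z}^d$. $C_n=[-n,n]^d\cap\mathbb{Z}^d$. $\Omega_S=\{-1,+1\}^{\mathbb{Z}^d}$ has the product topology and Borel $\sigma$-algebra. $\mathcal{F}_\Lambda$ is the $\sigma$-algebra generated by the spins $\sigma_x$, $x\in\Lambda$; $f\in\mathcal{F}_\Lambda$ means that $f:\Omega_S\to\mathbb{R}$ is $\mathcal{F}_\Lambda$-measurable. $\mu(\sigma_\Lambda)$ is the $\mu$-probability of the cylinder of configurations agreeing with $\sigma$ on $\Lambda$. PCA: real coefficients $(r_A)_{A\Subset\mathbb{Z}^d}$ with $\sum_A|r_A|<\infty$ are given; for $\eta\in\Omega_S$ and $x\in\mathbb{Z}^d$ set $h_x(\eta)=\sum_{A\Subset\mathbb{Z}^d} r_A\,\eta_{A+x}$, where $\eta_B=\prod_{y\in B}\eta_y$, and assume $|h_x(\eta)|\le 1$ for all $\eta$ and $x$. Given $\eta$, $p(d\sigma|\eta)$ is the product probability measure on $\Omega_S$ with marginals $p(\sigma_x=s\,|\,\eta)=\frac12(1+s\,h_x(\eta))$, $s\in\{-1,+1\}$. $Pf(\eta)=\int f(\sigma)\,p(d\sigma|\eta)$ and $\mu P(d\sigma)=\int p(d\sigma|\eta)\,\mu(d\eta)$; $\mu$ is stationary if $\mu P=\mu$. Oscillations and GCB: a function is local if it depends on finitely many coordinates. $\delta_x f=\sup_{\sigma}\big(f(\sigma^{(x)})-f(\sigma)\big)$,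 where $\sigma^{(x)}$ is $\sigma$ with the spin at $x$ flipped, $\delta f=(\delta_x f)_{x\in\mathbb{Z}^d}$, and $\|\cdot\|_p$ is the $\ell^p(\mathbb{Z}^d)$ norm. $\mu$ satisfies $\mathrm{GCB}(C)$ if $\log\int e^{f-\int f\,d\mu}\,d\mu\le\frac{C}{2}\|\delta f\|_2^2$ for every local $f:\Omega_S\to\mathbb{R}$. Locality: the PCA is local with propagation speed $a\in\mathbb{N}$ if for all $n,k\in\mathbb{N}$ and $f\in\mathcal{F}_{C_n}$ one has $P^kf\in\mathcal{F}_{C_{n+ak}}$. Contraction speed: the PCA has contraction speed $\psi_n:\mathbb{Z}^d\to\mathbb{R}^+$, $n\in\mathbb{N}$, if for all $n\in\mathbb{N}$ and all local $f$, $\delta_x(P^nf)\le(\psi_n*\delta f)_x=\sum_{y}\psi_n(x-y)\,\delta_yf$ for all $x\in\mathbb{Z}^d$. Relative entropy in volume $\Lambda$: $s_\Lambda(\nu|\mu)=\sum_{\sigma_\Lambda\in\{-1,+1\}^\Lambda}\nu(\sigma_\Lambda)\log\frac{\nu(\sigma_\Lambda)}{\mu(\sigma_\Lambda)}$ if the restriction of $\nu$ to $\mathcal{F}_\Lambda$ is absolutely continuous with respect to that of $\mu$, and $+\infty$ otherwise. Distances: $D_{\infty,\Lambda}(\mu,\nu)=\sup\{\int f\,d\mu-\int f\,d\nu: f\in\mathcal{F}_\Lambda,\ \|\delta f\|_1\le1\}$; $D_{2,\Lambda}(\mu,\nu)=\sup\{\int f\,d\mu-\int f\,d\nu: f\in\mathcal{F}_\Lambda,\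 \|\delta f\|_2\le1\}$; for translation-invariant $\mu,\nu$, $\bar d(\nu,\mu)=\sup\{\int f\,d\mu-\int f\,d\nu:\|\delta f\|_1\le1\}$, the supremum being over continuous $f:\Omega_S\to\mathbb{R}$. *)

theory Defs
  imports "HOL-Probability.Probability"
begin

text \<open>
  The lattice \<open>\<int>\<^sup>d\<close> is \<^typ>\<open>int ^ 'd\<close>, the dimension being the cardinality of the finite index type.
  The two-point spin space is \<^typ>\<open>bool\<close>, whose values are read as \<open>+1\<close> and \<open>-1\<close> via \<open>spin\<close>;
  \<open>\<Omega>\<^sub>S\<close> is then the whole function type with its product topology, and its Borel
  \<open>\<sigma>\<close>-algebra is \<^const>\<open>borel\<close>.
\<close>

type_synonym 'd site = "int ^ 'd"
type_synonym 'd config = "(int ^ 'd) \<Rightarrow> bool"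

definition spin :: "bool \<Rightarrow> real" where
  "spin b = (if b then 1 else -1)"

definition cube :: "nat \<Rightarrow> ('d::finite) site set" where
  "cube n = {x. \<forall>i. - int n \<le> x $ i \<and> x $ i \<le> int n}"

definition flip :: "('d::finite) site \<Rightarrow> 'd config \<Rightarrow> 'd config" where
  "flip x \<sigma> = \<sigma>(x := \<not> \<sigma> x)"

definition translate :: "('d::finite) site \<Rightarrow> 'd config \<Rightarrow> 'd config" where
  "translate x \<sigma> = (\<lambda>y. \<sigma> (y + x))"

definition is_local :: "(('d::finite) config \<Rightarrow> real) \<Rightarrow> bool" where
  "is_local f \<longleftrightarrow>
     (\<exists>\<Lambda>. finite \<Lambda> \<and> (\<forall>\<sigma> \<tau>. (\<forall>x\<in>\<Lambda>. \<sigma> x = \<tau> x) \<longrightarrow> f \<sigma> = f \<tau>))"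

definition spin_algebra :: "('d::finite) site set \<Rightarrow> 'd config measure" where
  "spin_algebra \<Lambda> = sigma UNIV {{\<sigma>. \<sigma> x = s} | x s. x \<in> \<Lambda>}"

definition cylinder :: "('d::finite) site set \<Rightarrow> 'd config \<Rightarrow> 'd config set" where
  "cylinder \<Lambda> \<sigma> = {\<tau>. \<forall>x\<in>\<Lambda>. \<tau> x = \<sigma> x}"

definition probability_on_configs :: "('d::finite) config measure \<Rightarrow> bool" where
  "probability_on_configs \<mu> \<longleftrightarrow> prob_space \<mu> \<and> sets \<mu> = sets borel"

definition translation_invariant :: "('d::finite) config measure \<Rightarrow> bool" where
  "translation_invariant \<mu> \<longleftrightarrow> (\<forall>x. distr \<mu> borel (translate x) = \<mu>)"


section \<open>Oscillations and norms\<close>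

definition osc :: "(('d::finite) config \<Rightarrow> real) \<Rightarrow> 'd site \<Rightarrow> real" where
  "osc f x = (SUP \<sigma>. f (flip x \<sigma>) - f \<sigma>)"

text \<open>The \<open>\<ell>\<^sup>p\<close> norm for finite \<open>p\<close>, with value \<open>\<infinity>\<close> off \<open>\<ell>\<^sup>p\<close>.\<close>

definition lp_norm :: "real \<Rightarrow> (('d::finite) site \<Rightarrow> real) \<Rightarrow> ereal" where
  "lp_norm p u =
     (if (\<lambda>x. \<bar>u x\<bar> powr p) summable_on UNIV
      then ereal ((\<Sum>\<^sub>\<infinity>x. \<bar>u x\<bar> powr p) powr (1 / p)) else \<infinity>)"

definition GCB :: "real \<Rightarrow> ('d::finite) config measure \<Rightarrow> bool" where
  "GCB C \<mu> \<longleftrightarrow>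
     (\<forall>f. is_local f \<longrightarrow>
        ereal (ln (\<integral>\<sigma>. exp (f \<sigma> - (\<integral>\<tau>. f \<tau> \<partial>\<mu>)) \<partial>\<mu>)) \<le> ereal (C / 2) * (lp_norm 2 (osc f))\<^sup>2)"

definition finite_energy :: "real \<Rightarrow> ('d::finite) config measure \<Rightarrow> bool" where
  "finite_energy \<rho> \<mu> \<longleftrightarrow>
     (\<forall>\<sigma> \<Lambda>. finite \<Lambda> \<longrightarrow> exp (- \<rho> * real (card \<Lambda>)) \<le> measure \<mu> (cylinder \<Lambda> \<sigma>))"


section \<open>Probabilistic cellular automata\<close>

definition pca_field :: "(('d::finite) site set \<Rightarrow> real) \<Rightarrow> 'd site \<Rightarrow> 'd config \<Rightarrow> real" where
  "pca_field r x \<eta> = (\<Sum>\<^sub>\<infinity>A\<in>{A. finite A}. r A * (\<Prod>y\<in>(\<lambda>a. a + x) ` A. spin (\<eta> y)))"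

definition is_pca :: "(('d::finite) site set \<Rightarrow> real) \<Rightarrow> bool" where
  "is_pca r \<longleftrightarrow>
     (\<lambda>A. \<bar>r A\<bar>) summable_on {A. finite A} \<and> (\<forall>x \<eta>. \<bar>pca_field r x \<eta>\<bar> \<le> 1)"

definition pca_kernel :: "(('d::finite) site set \<Rightarrow> real) \<Rightarrow> 'd config \<Rightarrow> 'd config measure" where
  "pca_kernel r \<eta> = PiM UNIV (\<lambda>x. measure_pmf (bernoulli_pmf ((1 + pca_field r x \<eta>) / 2)))"

definition pca_op :: "(('d::finite) site set \<Rightarrow> real) \<Rightarrow> ('d config \<Rightarrow> real) \<Rightarrow> 'd config \<Rightarrow> real" where
  "pca_op r f \<eta> = (\<integral>\<sigma>. f \<sigma> \<partial>pca_kernel r \<eta>)"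

definition pca_step :: "(('d::finite) site set \<Rightarrow> real) \<Rightarrow> 'd config measure \<Rightarrow> 'd config measure" where
  "pca_step r \<mu> = \<mu> \<bind> pca_kernel r"

text \<open>
  The monadic bind is meaningful only for a measurable kernel; measurability is established below,
  and with it the integral formula for \<open>\<mu>P\<close>.
\<close>

instance bool :: second_countable_topology
proof
  show "\<exists>B :: bool set set. countable B \<and> open = generate_topology B"
  proof (intro exI conjI ext)
    show "countable (UNIV :: bool set set)" by simp
    show "open S = generate_topology UNIV S" for S :: "bool set"
      by (simp add: generate_topology.Basis Topological_Spaces.open_discrete)
  qed
qed

lemma sets_PiM_spins:
  assumes "\<And>x. sets (M x) = (UNIV :: bool set set)"
  shows "sets (PiM UNIV M) = sets (borel :: ('d::finite) config measure)"
proof -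
  have b: "sets (borel :: bool measure) = UNIV" by (auto intro: borel_open Topological_Spaces.open_discrete)
  show ?thesis
    by (subst sets_PiM_equal_borel[symmetric], rule sets_PiM_cong) (auto simp: assms b)
qed

lemma sets_pca_kernel: "sets (pca_kernel r \<eta>) = sets (borel :: ('d::finite) config measure)"
  unfolding pca_kernel_def by (rule sets_PiM_spins) simp

lemma prob_space_pca_kernel: "prob_space (pca_kernel r \<eta>)"
  unfolding pca_kernel_def by (intro prob_space_PiM measure_pmf.prob_space_axioms)

lemma pmf_pca:
  assumes "is_pca r"
  shows "pmf (bernoulli_pmf ((1 + pca_field r x \<eta>) / 2)) s = 1 / 2 * (1 + spin s * pca_field r x \<eta>)"
proof -
  have "\<bar>pca_field r x \<eta>\<bar> \<le> 1" using assms by (simp add: is_pca_def)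
  then show ?thesis by (cases s) (auto simp: spin_def field_simps)
qed

lemma measurable_spin_at [measurable]:
  "(\<lambda>\<eta>. \<eta> x) \<in> (borel :: ('d::finite) config measure) \<rightarrow>\<^sub>M (borel :: bool measure)"
proof -
  have "(\<lambda>\<eta>. \<eta> x) \<in> PiM UNIV (\<lambda>i::'d site. borel :: bool measure) \<rightarrow>\<^sub>M (borel :: bool measure)" by simp
  then show ?thesis
    by (subst measurable_cong_sets[OF sets_PiM_equal_borel[symmetric] refl]) assumption
qed

lemma pca_field_measurable:
  assumes "is_pca (r :: ('d::finite) site set \<Rightarrow> real)"
  shows "pca_field r x \<in> borel_measurable borel"
proof -
  let ?F = "{A :: 'd site set. finite A}"
  let ?g = "\<lambda>\<eta> A. r A * (\<Prod>y\<in>(\<lambda>a. a + x) ` A. spin (\<eta> y))"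
  have c: "countable ?F" using countable_Collect_finite by blast
  have abs: "\<bar>\<Prod>y\<in>B. spin (\<eta> y)\<bar> = 1" for B \<eta>
    by (simp add: abs_prod spin_def if_distrib cong: if_cong)
  have "Infinite_Set_Sum.abs_summable_on (?g \<eta>) ?F" for \<eta>
    using assms unfolding is_pca_def abs_summable_equivalent[symmetric] by (simp add: abs_mult abs)
  then have e: "pca_field r x = (\<lambda>\<eta>. \<integral>A. ?g \<eta> A \<partial>count_space ?F)"
    unfolding pca_field_def using infsetsum_infsum by (metis (no_types, lifting) ext infsetsum_def)
  have sm: "spin \<in> borel_measurable borel"
    by (intro borel_measurable_continuous_onI) (simp add: continuous_on_open_vimage Topological_Spaces.open_discrete)
  have [measurable]: "(\<lambda>\<eta>. spin (\<eta> y)) \<in> borel_measurable (borel :: 'd config measure)" for y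
    by (rule measurable_compose[OF measurable_spin_at sm])
  have "(\<lambda>(\<eta>, A). ?g \<eta> A) \<in> borel_measurable (borel \<Otimes>\<^sub>M count_space ?F)"
  proof -
    have "(\<lambda>(A, \<eta>). ?g \<eta> A) \<in> borel_measurable (count_space ?F \<Otimes>\<^sub>M borel)"
      by (rule measurable_pair_measure_countable1[OF c]) simp
    from measurable_compose[OF measurable_pair_swap' this] show ?thesis
      by (simp add: case_prod_beta')
  qed
  then show ?thesis unfolding e
    by (intro sigma_finite_measure.borel_measurable_lebesgue_integral
        sigma_finite_measure_count_space_countable c)
qed

lemma pca_kernel_measurable:
  assumes "is_pca (r :: ('d::finite) site set \<Rightarrow> real)"
  shows "pca_kernel r \<in> borel \<rightarrow>\<^sub>M prob_algebra borel"
proof (rule measurable_prob_algebra_generated)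
  let ?M = "\<lambda>_::'d site. count_space (UNIV :: bool set)"
  let ?G = "prod_algebra UNIV ?M"
  have s: "sets (PiM UNIV ?M) = sets (borel :: 'd config measure)"
    by (rule sets_PiM_spins) simp
  show "sets (borel :: 'd config measure) = sigma_sets UNIV ?G"
    by (subst s[symmetric], subst sets_PiM) simp
  show "Int_stable ?G" by (rule Int_stable_prod_algebra)
  show "?G \<subseteq> Pow UNIV" by simp
  show "prob_space (pca_kernel r \<eta>)" for \<eta> by (rule prob_space_pca_kernel)
  show "sets (pca_kernel r \<eta>) = sets borel" for \<eta> by (rule sets_pca_kernel)
  fix A assume "A \<in> ?G"
  then obtain J E where A: "A = prod_emb UNIV ?M J (Pi\<^sub>E J E)" "finite J" by (auto elim!: prod_algebraE)
  have A': "A = prod_emb UNIV (\<lambda>x. measure_pmf (bernoulli_pmf ((1 + pca_field r x \<eta>) / 2))) J (Pi\<^sub>E J E)" for \<eta>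
    unfolding A by (simp add: prod_emb_def)
  have m: "emeasure (measure_pmf (bernoulli_pmf ((1 + pca_field r x \<eta>) / 2))) X =
      (\<Sum>s\<in>X. ennreal (1 / 2 * (1 + spin s * pca_field r x \<eta>)))" for x \<eta> X
  proof -
    have "emeasure (measure_pmf (bernoulli_pmf ((1 + pca_field r x \<eta>) / 2))) X =
        (\<Sum>s\<in>X. ennreal (pmf (bernoulli_pmf ((1 + pca_field r x \<eta>) / 2)) s))"
      by (subst emeasure_measure_pmf_finite) (simp_all only: finite sum_ennreal pmf_nonneg)
    then show ?thesis by (simp only: pmf_pca[OF assms])
  qed
  have "emeasure (pca_kernel r \<eta>) A =
     (\<Prod>x\<in>J. \<Sum>s\<in>E x. ennreal (1 / 2 * (1 + spin s * pca_field r x \<eta>)))" for \<eta>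
  proof -
    let ?B = "\<lambda>x. measure_pmf (bernoulli_pmf ((1 + pca_field r x \<eta>) / 2))"
    interpret product_prob_space ?B UNIV
      by (simp add: product_prob_space_def product_prob_space_axioms_def product_sigma_finite_def
          measure_pmf.sigma_finite_measure_axioms measure_pmf.prob_space_axioms)
    have "emeasure (PiM UNIV ?B) A = (\<Prod>x\<in>J. emeasure (?B x) (E x))"
      by (subst A'[of \<eta>], rule emeasure_PiM_emb) (simp_all add: A)
    then show ?thesis by (simp only: pca_kernel_def m)
  qed
  then show "(\<lambda>\<eta>. emeasure (pca_kernel r \<eta>) A) \<in> borel_measurable borel"
    using pca_field_measurable[OF assms] by simp
qed

lemma
  assumes "is_pca r" "probability_on_configs \<mu>"
  shows probability_on_configs_pca_step: "probability_on_configs (pca_step r \<mu>)"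
    and emeasure_pca_step: "A \<in> sets borel \<Longrightarrow> emeasure (pca_step r \<mu>) A = (\<integral>\<^sup>+\<eta>. emeasure (pca_kernel r \<eta>) A \<partial>\<mu>)"
proof -
  have m: "\<mu> \<in> space (prob_algebra borel)" using assms(2)
    by (auto simp: probability_on_configs_def space_prob_algebra)
  have k: "pca_kernel r \<in> \<mu> \<rightarrow>\<^sub>M prob_algebra borel"
    using pca_kernel_measurable[OF assms(1)] assms(2)
    by (simp add: probability_on_configs_def cong: measurable_cong_sets)
  have ne: "space \<mu> \<noteq> {}" using assms(2) prob_space.not_empty by (auto simp: probability_on_configs_def)
  show "probability_on_configs (pca_step r \<mu>)"
    unfolding probability_on_configs_def pca_step_def
    using prob_space_bind'[OF m pca_kernel_measurable[OF assms(1)]] sets_bind'[OF m pca_kernel_measurable[OF assms(1)]] by simp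
  show "A \<in> sets borel \<Longrightarrow> emeasure (pca_step r \<mu>) A = (\<integral>\<^sup>+\<eta>. emeasure (pca_kernel r \<eta>) A \<partial>\<mu>)"
    unfolding pca_step_def
    by (rule emeasure_bind[OF ne measurable_prob_algebraD[OF k]])
qed

definition stationary :: "(('d::finite) site set \<Rightarrow> real) \<Rightarrow> 'd config measure \<Rightarrow> bool" where
  "stationary r \<mu> \<longleftrightarrow> pca_step r \<mu> = \<mu>"

definition local_with_speed :: "(('d::finite) site set \<Rightarrow> real) \<Rightarrow> nat \<Rightarrow> bool" where
  "local_with_speed r a \<longleftrightarrow>
     (\<forall>n k. \<forall>f \<in> borel_measurable (spin_algebra (cube n)).
        (pca_op r ^^ k) f \<in> borel_measurable (spin_algebra (cube (n + a * k))))"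

definition contraction_speed ::
    "(('d::finite) site set \<Rightarrow> real) \<Rightarrow> (nat \<Rightarrow> 'd site \<Rightarrow> real) \<Rightarrow> bool" where
  "contraction_speed r \<psi> \<longleftrightarrow>
     (\<forall>n x. 0 \<le> \<psi> n x) \<and>
     (\<forall>n f. is_local f \<longrightarrow>
        (\<forall>x. osc ((pca_op r ^^ n) f) x \<le> (\<Sum>\<^sub>\<infinity>y. \<psi> n (x - y) * osc f y)))"


section \<open>Relative entropy and distances\<close>

text \<open>
  Patterns on \<open>\<Lambda>\<close> are extensional functions. The convention \<open>0 log 0 = 0\<close> is built in, and
  absolute continuity makes the terms with vanishing denominator vanish.
\<close>

definition rel_entropy ::
    "('d::finite) site set \<Rightarrow> 'd config measure \<Rightarrow> 'd config measure \<Rightarrow> ereal" where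
  "rel_entropy \<Lambda> \<nu> \<mu> =
     (if absolutely_continuous (restr_to_subalg \<mu> (spin_algebra \<Lambda>)) (restr_to_subalg \<nu> (spin_algebra \<Lambda>))
      then ereal (\<Sum>\<sigma>\<in>\<Lambda> \<rightarrow>\<^sub>E (UNIV :: bool set).
             measure \<nu> (cylinder \<Lambda> \<sigma>) * ln (measure \<nu> (cylinder \<Lambda> \<sigma>) / measure \<mu> (cylinder \<Lambda> \<sigma>)))
      else \<infinity>)"

definition D_inf :: "('d::finite) site set \<Rightarrow> 'd config measure \<Rightarrow> 'd config measure \<Rightarrow> ereal" where
  "D_inf \<Lambda> \<mu> \<nu> =
     (SUP f \<in> {f. f \<in> borel_measurable (spin_algebra \<Lambda>) \<and> lp_norm 1 (osc f) \<le> 1}.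
        ereal ((\<integral>\<sigma>. f \<sigma> \<partial>\<mu>) - (\<integral>\<sigma>. f \<sigma> \<partial>\<nu>)))"

definition D_two :: "('d::finite) site set \<Rightarrow> 'd config measure \<Rightarrow> 'd config measure \<Rightarrow> ereal" where
  "D_two \<Lambda> \<mu> \<nu> =
     (SUP f \<in> {f. f \<in> borel_measurable (spin_algebra \<Lambda>) \<and> lp_norm 2 (osc f) \<le> 1}.
        ereal ((\<integral>\<sigma>. f \<sigma> \<partial>\<mu>) - (\<integral>\<sigma>. f \<sigma> \<partial>\<nu>)))"

definition dbar :: "('d::finite) config measure \<Rightarrow> 'd config measure \<Rightarrow> ereal" where
  "dbar \<nu> \<mu> =
     (SUP f \<in> {f. continuous_on UNIV f \<and> lp_norm 1 (osc f) \<le> 1}.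
        ereal ((\<integral>\<sigma>. f \<sigma> \<partial>\<mu>) - (\<integral>\<sigma>. f \<sigma> \<partial>\<nu>)))"

end

theory Submission
  imports Defs "HOL-Real_Asymp.Real_Asymp"
begin

text \<open>
  For a function \<open>g\<close> of the spins in \<open>\<Lambda>\<close>, the Gibbs variational inequality and GCB applied to \<open>t g\<close> give
  \<open>t (\<integral>g d\<nu> - \<integral>g d\<mu>) \<le> s\<^sub>\<Lambda>(\<nu>|\<mu>) + C t\<^sup>2 \<parallel>\<delta>g\<parallel>\<^sup>2 / 2\<close> for all \<open>t \<ge> 0\<close>; optimising over \<open>t\<close> yields a
  transport-entropy inequality. Take \<open>g = P\<^sup>k f\<close>, use stationarity of \<open>\<mu>\<close>, and bound \<open>\<parallel>\<delta>g\<parallel>\<close> by Young's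
  convolution inequality. Finite energy bounds the entropy by \<open>\<rho> |\<Lambda>|\<close>. For translation-invariant \<open>\<nu>\<close>,
  summing the translates of \<open>f\<close> over a large cube multiplies the difference of integrals by the
  volume but \<open>\<parallel>\<delta>f\<parallel>\<^sub>2\<close> only by its square root, which offsets the volume in the entropy bound.
\<close>

section \<open>Functions of finitely many coordinates\<close>

text \<open>Pointwise stand-in for measurability with respect to \<open>spin_algebra\<close>. The
  codomain is arbitrary, so the notion covers membership predicates of events as well as real
  functions.\<close>

definition depends_on :: "('d::finite) site set \<Rightarrow> ('d config \<Rightarrow> 'b) \<Rightarrow> bool" where
  "depends_on \<Lambda> f \<longleftrightarrow> (\<forall>\<sigma> \<tau>. (\<forall>x\<in>\<Lambda>. \<sigma> x = \<tau> x) \<longrightarrow> f \<sigma> = f \<tau>)"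

lemma depends_onD: "depends_on \<Lambda> f \<Longrightarrow> (\<And>x. x \<in> \<Lambda> \<Longrightarrow> \<sigma> x = \<tau> x) \<Longrightarrow> f \<sigma> = f \<tau>"
  unfolding depends_on_def by blast

lemma is_local_iff: "is_local f \<longleftrightarrow> (\<exists>\<Lambda>. finite \<Lambda> \<and> depends_on \<Lambda> f)"
  unfolding is_local_def depends_on_def by blast

lemma depends_on_restrict: "depends_on \<Lambda> f \<Longrightarrow> f \<sigma> = f (restrict \<sigma> \<Lambda>)"
  by (rule depends_onD) auto

lemma depends_on_compose: "depends_on \<Lambda> f \<Longrightarrow> depends_on \<Lambda> (\<lambda>\<sigma>. g (f \<sigma>))"
  unfolding depends_on_def by metis

lemma finite_patterns: "finite \<Lambda> \<Longrightarrow> finite (\<Lambda> \<rightarrow>\<^sub>E (UNIV :: bool set))"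
  by (simp add: finite_PiE)

text \<open>The function factors through restriction to \<Lambda>, and there are only finitely many
  patterns there. Boundedness and integrability of local functions come from this.\<close>

lemma finite_range_depends_on:
  fixes f :: "('a::finite) config \<Rightarrow> 'b"
  assumes "finite \<Lambda>" "depends_on \<Lambda> f"
  shows "finite (range f)"
proof (rule finite_subset)
  show "range f \<subseteq> f ` (\<Lambda> \<rightarrow>\<^sub>E UNIV)"
  proof (intro image_subsetI)
    fix \<sigma> :: "'a config"
    have "restrict \<sigma> \<Lambda> \<in> \<Lambda> \<rightarrow>\<^sub>E UNIV" by simp
    then show "f \<sigma> \<in> f ` (\<Lambda> \<rightarrow>\<^sub>E UNIV)"
      using depends_on_restrict[OF assms(2), of \<sigma>] by (metis imageI)
  qed
qed (simp add: assms finite_patterns)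

lemma space_spin_algebra [simp]: "space (spin_algebra \<Lambda>) = UNIV"
  unfolding spin_algebra_def by (simp add: space_measure_of_conv)

lemma sets_spin_algebra: "sets (spin_algebra \<Lambda>) = sigma_sets UNIV {{\<sigma>. \<sigma> x = s} | x s. x \<in> \<Lambda>}"
  unfolding spin_algebra_def by (simp add: sets_measure_of)

lemma cylinder_in_spin_algebra:
  assumes "finite \<Lambda>"
  shows "cylinder \<Lambda> \<sigma> \<in> sets (spin_algebra \<Lambda>)"
proof -
  have s: "{\<tau>. \<tau> x = \<sigma> x} \<in> sets (spin_algebra \<Lambda>)" if "x \<in> \<Lambda>" for x
    unfolding sets_spin_algebra using that by (intro sigma_sets.Basic) auto
  have "{\<tau> \<in> space (spin_algebra \<Lambda>). \<forall>x\<in>\<Lambda>. \<tau> x = \<sigma> x} \<in> sets (spin_algebra \<Lambda>)"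
    using s by (intro sets.sets_Collect_finite_All assms) simp_all
  then show ?thesis by (simp add: cylinder_def)
qed

text \<open>Events decided by the spins in \<Lambda> include the generators and are closed under
  complements and countable unions, so induction over the generated \<sigma>-algebra
  applies.\<close>

lemma depends_on_spin_algebra_set:
  fixes A :: "('a::finite) config set"
  assumes "A \<in> sets (spin_algebra \<Lambda>)"
  shows "depends_on \<Lambda> (\<lambda>\<sigma>. \<sigma> \<in> A)"
  unfolding depends_on_def
proof (intro allI impI)
  fix \<sigma> \<tau> :: "'a config" assume eq: "\<forall>x\<in>\<Lambda>. \<sigma> x = \<tau> x"
  from assms show "(\<sigma> \<in> A) = (\<tau> \<in> A)" unfolding sets_spin_algebra
    by (induction rule: sigma_sets.induct) (use eq in auto)
qed

text \<open>Preimages of singletons give one direction. For the other, any preimage is a union of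
  cylinders, and finiteness of \<Lambda> makes that union finite.\<close>

lemma measurable_spin_algebra_iff:
  fixes f :: "('d::finite) config \<Rightarrow> real"
  assumes "finite \<Lambda>"
  shows "f \<in> borel_measurable (spin_algebra \<Lambda>) \<longleftrightarrow> depends_on \<Lambda> f"
proof
  assume f: "f \<in> borel_measurable (spin_algebra \<Lambda>)"
  show "depends_on \<Lambda> f" unfolding depends_on_def
  proof (intro allI impI)
    fix \<sigma> \<tau> :: "'d config" assume eq: "\<forall>x\<in>\<Lambda>. \<sigma> x = \<tau> x"
    have "f -` {f \<tau>} \<inter> space (spin_algebra \<Lambda>) \<in> sets (spin_algebra \<Lambda>)"
      using f by (rule measurable_sets) simp
    then have "f -` {f \<tau>} \<in> sets (spin_algebra \<Lambda>)" by simp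
    from depends_onD[OF depends_on_spin_algebra_set[OF this], of \<sigma> \<tau>] eq show "f \<sigma> = f \<tau>" by simp
  qed
next
  assume f: "depends_on \<Lambda> f"
  show "f \<in> borel_measurable (spin_algebra \<Lambda>)"
  proof (rule measurableI)
    fix B :: "real set" assume "B \<in> sets borel"
    have "f -` B = (\<Union>\<sigma>\<in>{\<sigma> \<in> \<Lambda> \<rightarrow>\<^sub>E UNIV. f \<sigma> \<in> B}. cylinder \<Lambda> \<sigma>)" (is "_ = ?R")
    proof (intro set_eqI iffI)
      fix \<tau> assume "\<tau> \<in> f -` B"
      then have "restrict \<tau> \<Lambda> \<in> {\<sigma> \<in> \<Lambda> \<rightarrow>\<^sub>E UNIV. f \<sigma> \<in> B}" "\<tau> \<in> cylinder \<Lambda> (restrict \<tau> \<Lambda>)"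
        using depends_on_restrict[OF f, of \<tau>] by (auto simp: cylinder_def)
      then show "\<tau> \<in> ?R" by blast
    next
      fix \<tau> assume "\<tau> \<in> ?R"
      then obtain \<sigma> where "f \<sigma> \<in> B" "\<tau> \<in> cylinder \<Lambda> \<sigma>" by auto
      moreover then have "f \<tau> = f \<sigma>" by (intro depends_onD[OF f]) (auto simp: cylinder_def)
      ultimately show "\<tau> \<in> f -` B" by simp
    qed
    also have "\<dots> \<in> sets (spin_algebra \<Lambda>)"
      using assms by (intro sets.finite_UN cylinder_in_spin_algebra) (simp_all add: finite_patterns)
    finally show "f -` B \<inter> space (spin_algebra \<Lambda>) \<in> sets (spin_algebra \<Lambda>)" by simp
  qed simp
qed

lemma sets_spin_algebra_subset: "sets (spin_algebra \<Lambda>) \<subseteq> sets (borel :: ('d::finite) config measure)"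
proof -
  have "{\<sigma> :: 'd config. \<sigma> x = s} \<in> sets borel" for x s
  proof -
    have "(\<lambda>\<sigma> :: 'd config. \<sigma> x) -` {s} \<inter> space borel \<in> sets borel"
      by (rule measurable_sets[OF measurable_spin_at]) (simp add: borel_open Topological_Spaces.open_discrete)
    then show ?thesis by (simp add: vimage_def)
  qed
  then show ?thesis
    unfolding sets_spin_algebra by (intro sets.sigma_sets_subset[of _ borel, simplified]) auto
qed

lemma depends_on_borel_measurable:
  fixes f :: "('d::finite) config \<Rightarrow> real"
  assumes "finite \<Lambda>" "depends_on \<Lambda> f"
  shows "f \<in> borel_measurable borel"
  using measurable_spin_algebra_iff[THEN iffD2, OF assms] sets_spin_algebra_subset[of \<Lambda>]
  by (auto simp: measurable_def)

lemma probability_on_configsD: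
  assumes "probability_on_configs \<mu>"
  shows "prob_space \<mu>" "sets \<mu> = sets borel" "space \<mu> = UNIV"
  using assms sets_eq_imp_space_eq[of \<mu> borel] by (auto simp: probability_on_configs_def)

lemma depends_on_integrable:
  fixes f :: "('d::finite) config \<Rightarrow> real"
  assumes "probability_on_configs \<mu>" "finite \<Lambda>" "depends_on \<Lambda> f"
  shows "integrable \<mu> f"
proof -
  interpret prob_space \<mu> using assms(1) by (rule probability_on_configsD)
  obtain B where "\<And>\<sigma>. norm (f \<sigma>) \<le> B"
    using finite_imp_bounded[OF finite_range_depends_on[OF assms(2,3)]] unfolding bounded_iff by auto
  then show ?thesis
    using depends_on_borel_measurable[OF assms(2,3)] probability_on_configsD(2)[OF assms(1)]
    by (intro integrable_const_bound[of _ B]) (auto cong: measurable_cong_sets)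
qed

lemma cylinder_in_sets:
  assumes "probability_on_configs \<mu>" "finite \<Lambda>"
  shows "cylinder \<Lambda> \<sigma> \<in> sets \<mu>"
  using cylinder_in_spin_algebra[OF assms(2)] sets_spin_algebra_subset[of \<Lambda>]
    probability_on_configsD(2)[OF assms(1)] by auto

text \<open>A function of finitely many spins is a finite combination of cylinder indicators.
  Entropy and exponential moments can then be compared as finite sums over the same
  patterns.\<close>

lemma integral_depends_on:
  fixes f :: "('d::finite) config \<Rightarrow> real"
  assumes \<mu>: "probability_on_configs \<mu>" and \<Lambda>: "finite \<Lambda>" and f: "depends_on \<Lambda> f"
  shows "(\<integral>\<sigma>. f \<sigma> \<partial>\<mu>) = (\<Sum>\<sigma>\<in>\<Lambda> \<rightarrow>\<^sub>E UNIV. measure \<mu> (cylinder \<Lambda> \<sigma>) * f \<sigma>)"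
proof -
  interpret prob_space \<mu> using \<mu> by (rule probability_on_configsD)
  \<comment> \<open>Cylinders over extensional patterns partition the space: each configuration lies
    only in the cylinder of its own restriction.\<close>
  have c: "\<tau> \<in> cylinder \<Lambda> \<sigma> \<longleftrightarrow> \<sigma> = restrict \<tau> \<Lambda>" if "\<sigma> \<in> \<Lambda> \<rightarrow>\<^sub>E UNIV" for \<sigma> \<tau>
    using that by (auto simp: cylinder_def PiE_def extensional_def restrict_def fun_eq_iff)
  have eq: "f \<tau> = (\<Sum>\<sigma>\<in>\<Lambda> \<rightarrow>\<^sub>E UNIV. f \<sigma> * indicator (cylinder \<Lambda> \<sigma>) \<tau>)" for \<tau>
  proof -
    have "(\<Sum>\<sigma>\<in>\<Lambda> \<rightarrow>\<^sub>E UNIV. f \<sigma> * indicator (cylinder \<Lambda> \<sigma>) \<tau>) =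
        (\<Sum>\<sigma>\<in>\<Lambda> \<rightarrow>\<^sub>E UNIV. if \<sigma> = restrict \<tau> \<Lambda> then f \<sigma> else 0)"
      by (intro sum.cong refl) (simp add: c indicator_def)
    also have "\<dots> = f (restrict \<tau> \<Lambda>)" using \<Lambda> by (simp add: finite_patterns)
    finally show ?thesis using depends_on_restrict[OF f] by simp
  qed
  have "(\<integral>\<sigma>. f \<sigma> \<partial>\<mu>) = (\<Sum>\<sigma>\<in>\<Lambda> \<rightarrow>\<^sub>E UNIV. \<integral>\<tau>. f \<sigma> * indicator (cylinder \<Lambda> \<sigma>) \<tau> \<partial>\<mu>)"
    by (subst eq, rule Bochner_Integration.integral_sum)
      (auto intro!: integrable_mult_right integrable_real_indicator cylinder_in_sets \<mu> \<Lambda> simp: emeasure_eq_measure)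
  also have "\<dots> = (\<Sum>\<sigma>\<in>\<Lambda> \<rightarrow>\<^sub>E UNIV. measure \<mu> (cylinder \<Lambda> \<sigma>) * f \<sigma>)"
    using cylinder_in_sets[OF \<mu> \<Lambda>]  probability_on_configsD(3)[OF \<mu>] by (simp add: mult.commute)
  finally show ?thesis .
qed

lemma sum_cylinder:
  assumes "probability_on_configs \<mu>" "finite \<Lambda>"
  shows "(\<Sum>\<sigma>\<in>\<Lambda> \<rightarrow>\<^sub>E UNIV. measure \<mu> (cylinder \<Lambda> \<sigma>)) = 1"
  using integral_depends_on[OF assms, of "\<lambda>_. 1"] prob_space.prob_space[OF probability_on_configsD(1)[OF assms(1)]]
  by (simp add: depends_on_def)


section \<open>Relative entropy\<close>

text \<open>The real number in the finite branch of \<open>rel_entropy\<close>, separated from the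
  test for absolute continuity.\<close>

definition local_entropy :: "('d::finite) site set \<Rightarrow> 'd config measure \<Rightarrow> 'd config measure \<Rightarrow> real" where
  "local_entropy \<Lambda> \<nu> \<mu> = (\<Sum>\<sigma>\<in>\<Lambda> \<rightarrow>\<^sub>E UNIV.
     measure \<nu> (cylinder \<Lambda> \<sigma>) * ln (measure \<nu> (cylinder \<Lambda> \<sigma>) / measure \<mu> (cylinder \<Lambda> \<sigma>)))"

lemma finite_energy_pos: "finite_energy \<rho> \<mu> \<Longrightarrow> finite \<Lambda> \<Longrightarrow> 0 < measure \<mu> (cylinder \<Lambda> \<sigma>)"
  unfolding finite_energy_def by (meson exp_gt_zero less_le_trans)

text \<open>A nonempty event of \<open>spin_algebra\<close> contains a whole cylinder, which has
  positive \<mu>-measure. Only the empty set is null, so absolute continuity is automatic and the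
  value \<infinity> never occurs.\<close>

lemma rel_entropy_finite_energy:
  fixes \<mu> \<nu> :: "('d::finite) config measure"
  assumes \<mu>: "probability_on_configs \<mu>" and fe: "finite_energy \<rho> \<mu>"
    and \<nu>: "probability_on_configs \<nu>" and \<Lambda>: "finite \<Lambda>"
  shows "rel_entropy \<Lambda> \<nu> \<mu> = ereal (local_entropy \<Lambda> \<nu> \<mu>)"
proof -
  interpret prob_space \<mu> using \<mu> by (rule probability_on_configsD)
  have sub: "subalgebra \<kappa> (spin_algebra \<Lambda>)" if "probability_on_configs \<kappa>" for \<kappa> :: "'d config measure"
    using probability_on_configsD[OF that] sets_spin_algebra_subset[of \<Lambda>] by (auto simp: subalgebra_def)
  have "A = {}" if "A \<in> null_sets (restr_to_subalg \<mu> (spin_algebra \<Lambda>))" for A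
  proof (rule ccontr)
    assume "A \<noteq> {}"
    then obtain \<sigma> where \<sigma>: "\<sigma> \<in> A" by auto
    from that have A: "A \<in> sets (spin_algebra \<Lambda>)" "A \<in> null_sets \<mu>"
      using sub[OF \<mu>] null_sets_restr_to_subalg by auto
    have "\<tau> \<in> A" if "\<tau> \<in> cylinder \<Lambda> \<sigma>" for \<tau>
      using that depends_onD[OF depends_on_spin_algebra_set[OF A(1)], of \<sigma> \<tau>] \<sigma> by (auto simp: cylinder_def)
    then have "cylinder \<Lambda> \<sigma> \<subseteq> A" by blast
    then have "measure \<mu> (cylinder \<Lambda> \<sigma>) \<le> measure \<mu> A"
      using A(2) by (intro finite_measure_mono) (simp_all add: null_sets_def)
    then show False using A(2) finite_energy_pos[OF fe \<Lambda>, of \<sigma>] by (simp add: measure_eq_0_null_sets)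
  qed
  then have "absolutely_continuous (restr_to_subalg \<mu> (spin_algebra \<Lambda>)) (restr_to_subalg \<nu> (spin_algebra \<Lambda>))"
    unfolding absolutely_continuous_def by auto
  then show ?thesis unfolding rel_entropy_def local_entropy_def by simp
qed

text \<open>Each logarithm is at most -ln q, because p \<le> 1, and finite energy bounds -ln q by
  \<rho> times the volume. The weights p sum to one.\<close>

lemma local_entropy_le:
  assumes \<mu>: "probability_on_configs \<mu>" and fe: "finite_energy \<rho> \<mu>"
    and \<nu>: "probability_on_configs \<nu>" and \<Lambda>: "finite \<Lambda>"
  shows "local_entropy \<Lambda> \<nu> \<mu> \<le> \<rho> * card \<Lambda>"
proof -
  interpret \<nu>: prob_space \<nu> using \<nu> by (rule probability_on_configsD)
  have "local_entropy \<Lambda> \<nu> \<mu> \<le> (\<Sum>\<sigma>\<in>\<Lambda> \<rightarrow>\<^sub>E UNIV. measure \<nu> (cylinder \<Lambda> \<sigma>) * (\<rho> * card \<Lambda>))"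
    unfolding local_entropy_def
  proof (intro sum_mono)
    fix \<sigma>
    let ?p = "measure \<nu> (cylinder \<Lambda> \<sigma>)" and ?q = "measure \<mu> (cylinder \<Lambda> \<sigma>)"
    have q: "0 < ?q" "exp (- \<rho> * card \<Lambda>) \<le> ?q"
      using fe \<Lambda> finite_energy_pos by (auto simp: finite_energy_def)
    from q have "- \<rho> * card \<Lambda> \<le> ln ?q" by (simp add: ln_ge_iff)
    then show "?p * ln (?p / ?q) \<le> ?p * (\<rho> * card \<Lambda>)"
    proof (cases "?p = 0")
      case False
      then have "0 < ?p" by (simp add: zero_less_measure_iff)
      moreover have "ln ?p \<le> 0" using \<open>0 < ?p\<close> \<nu>.prob_le_1 by simp
      ultimately have "ln (?p / ?q) \<le> \<rho> * card \<Lambda>"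
        using ln_divide_pos[of ?p ?q] q(1) \<open>- \<rho> * card \<Lambda> \<le> ln ?q\<close> by linarith
      then show ?thesis by (rule mult_left_mono) simp
    qed simp
  qed
  also have "\<dots> = \<rho> * card \<Lambda>" using sum_cylinder[OF \<nu> \<Lambda>] by (simp flip: sum_distrib_right)
  finally show ?thesis .
qed

text \<open>The Gibbs variational inequality: \<nu> is compared with the tilted law of weights q
  exp(g) / Z, using ln t \<le> t - 1.\<close>

lemma gibbs_inequality:
  fixes g :: "('d::finite) config \<Rightarrow> real"
  assumes \<mu>: "probability_on_configs \<mu>" and fe: "finite_energy \<rho> \<mu>"
    and \<nu>: "probability_on_configs \<nu>" and \<Lambda>: "finite \<Lambda>" and g: "depends_on \<Lambda> g"
  shows "(\<integral>\<sigma>. g \<sigma> \<partial>\<nu>) \<le> local_entropy \<Lambda> \<nu> \<mu> + ln (\<integral>\<sigma>. exp (g \<sigma>) \<partial>\<mu>)"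
proof -
  let ?I = "\<Lambda> \<rightarrow>\<^sub>E (UNIV :: bool set)"
  let ?p = "\<lambda>\<sigma>. measure \<nu> (cylinder \<Lambda> \<sigma>)" and ?q = "\<lambda>\<sigma>. measure \<mu> (cylinder \<Lambda> \<sigma>)"
  define Z where "Z = (\<Sum>\<sigma>\<in>?I. ?q \<sigma> * exp (g \<sigma>))"
  have Z: "(\<integral>\<sigma>. exp (g \<sigma>) \<partial>\<mu>) = Z"
    unfolding Z_def by (rule integral_depends_on[OF \<mu> \<Lambda> depends_on_compose[OF g]])
  have q: "0 < ?q \<sigma>" for \<sigma> by (rule finite_energy_pos[OF fe \<Lambda>])
  have ne: "?I \<noteq> {}" by (simp add: PiE_eq_empty_iff)
  have Zpos: "0 < Z" unfolding Z_def using q ne \<Lambda> by (intro sum_pos finite_patterns) auto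
  have "?p \<sigma> * (g \<sigma> - ln (?p \<sigma> / ?q \<sigma>) - ln Z) \<le> ?q \<sigma> * exp (g \<sigma>) / Z - ?p \<sigma>" for \<sigma>
  proof (cases "?p \<sigma> = 0")
    case True
    then show ?thesis using q[of \<sigma>] Zpos by simp
  next
    case False
    then have p: "0 < ?p \<sigma>" by (simp add: zero_less_measure_iff)
    \<comment> \<open>The ratio of the tilted weight to the \<nu>-weight of the pattern.\<close>
    define t where "t = ?q \<sigma> * exp (g \<sigma>) / (Z * ?p \<sigma>)"
    have "0 < t" unfolding t_def using p q[of \<sigma>] Zpos by simp
    have "g \<sigma> - ln (?p \<sigma> / ?q \<sigma>) - ln Z = ln t"
      unfolding t_def using p q[of \<sigma>] Zpos by (simp add: ln_div ln_mult)
    also have "\<dots> \<le> t - 1" by (rule ln_le_minus_one) fact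
    finally have "?p \<sigma> * (g \<sigma> - ln (?p \<sigma> / ?q \<sigma>) - ln Z) \<le> ?p \<sigma> * (t - 1)"
      by (rule mult_left_mono) simp
    also have "\<dots> = ?q \<sigma> * exp (g \<sigma>) / Z - ?p \<sigma>" unfolding t_def using p by (simp add: field_simps)
    finally show ?thesis .
  qed
  then have "(\<Sum>\<sigma>\<in>?I. ?p \<sigma> * (g \<sigma> - ln (?p \<sigma> / ?q \<sigma>) - ln Z)) \<le> (\<Sum>\<sigma>\<in>?I. ?q \<sigma> * exp (g \<sigma>) / Z - ?p \<sigma>)"
    by (rule sum_mono)
  \<comment> \<open>Both the tilted weights and the \<nu>-weights have total mass one.\<close>
  also have "\<dots> = 0"
    using Zpos sum_cylinder[OF \<nu> \<Lambda>] by (simp add: sum_subtractf Z_def flip: sum_divide_distrib)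
  also have "(\<Sum>\<sigma>\<in>?I. ?p \<sigma> * (g \<sigma> - ln (?p \<sigma> / ?q \<sigma>) - ln Z)) =
      (\<Sum>\<sigma>\<in>?I. ?p \<sigma> * g \<sigma>) - local_entropy \<Lambda> \<nu> \<mu> - (\<Sum>\<sigma>\<in>?I. ?p \<sigma>) * ln Z"
    unfolding local_entropy_def by (simp add: right_diff_distrib sum_subtractf sum_distrib_right)
  finally show ?thesis
    unfolding Z integral_depends_on[OF \<nu> \<Lambda> g] using sum_cylinder[OF \<nu> \<Lambda>] by simp
qed

lemma local_entropy_nonneg:
  assumes "probability_on_configs \<mu>" "finite_energy \<rho> \<mu>" "probability_on_configs \<nu>" "finite \<Lambda>"
  shows "0 \<le> local_entropy \<Lambda> \<nu> \<mu>"
  using gibbs_inequality[OF assms, of "\<lambda>_. 0"] prob_space.prob_space[OF probability_on_configsD(1)[OF assms(1)]]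
  by (simp add: depends_on_def)

section \<open>Oscillations\<close>

lemma flip_flip [simp]: "flip x (flip x \<sigma>) = \<sigma>"
  by (auto simp: flip_def)

lemma bounded_depends_on:
  fixes f :: "('d::finite) config \<Rightarrow> real"
  shows "finite \<Lambda> \<Longrightarrow> depends_on \<Lambda> f \<Longrightarrow> bounded (range f)"
  by (intro finite_imp_bounded finite_range_depends_on)

text \<open>Boundedness enters because a supremum of reals dominates its terms only when they are
  bounded above.\<close>

lemma le_osc:
  assumes "bounded (range f)"
  shows "f (flip x \<sigma>) - f \<sigma> \<le> osc f x"
proof -
  obtain B where B: "\<And>\<sigma>. \<bar>f \<sigma>\<bar> \<le> B" using assms unfolding bounded_iff by auto
  have "bdd_above (range (\<lambda>\<sigma>. f (flip x \<sigma>) - f \<sigma>))"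
  proof (intro bdd_aboveI2)
    show "f (flip x \<sigma>) - f \<sigma> \<le> 2 * B" for \<sigma> using B[of \<sigma>] B[of "flip x \<sigma>"] by linarith
  qed
  then show ?thesis unfolding osc_def by (rule cSUP_upper[OF UNIV_I])
qed

lemma osc_le: "(\<And>\<sigma>. f (flip x \<sigma>) - f \<sigma> \<le> b) \<Longrightarrow> osc f x \<le> b"
  unfolding osc_def by (rule cSUP_least) auto

text \<open>The differences at a configuration and at its flip are negatives of each other, so they
  cannot both be below zero.\<close>

lemma osc_nonneg:
  assumes "bounded (range f)"
  shows "0 \<le> osc f x"
  using le_osc[OF assms, of x "\<lambda>_. True"] le_osc[OF assms, of x "flip x (\<lambda>_. True)"] by simp

lemma osc_eq_0:
  assumes "depends_on \<Lambda> f" "x \<notin> \<Lambda>"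
  shows "osc f x = 0"
proof -
  have "f (flip x \<sigma>) = f \<sigma>" for \<sigma>
    using assms(2) by (intro depends_onD[OF assms(1)]) (auto simp: flip_def)
  then show ?thesis by (simp add: osc_def)
qed

text \<open>Flipping is an involution, so substituting the flipped configuration reverses every
  difference without changing the supremum.\<close>

lemma osc_uminus:
  fixes f :: "('a::finite) config \<Rightarrow> real"
  shows "osc (\<lambda>\<sigma>. - f \<sigma>) = osc f"
proof
  fix x :: "'a site"
  have "surj (flip x :: 'a config \<Rightarrow> 'a config)" by (rule surjI[of _ "flip x"]) simp
  then have "range (\<lambda>\<sigma>. f (flip x \<sigma>) - f \<sigma>) = range ((\<lambda>\<sigma>. f (flip x \<sigma>) - f \<sigma>) \<circ> flip x)"
    by (metis image_comp)
  then show "osc (\<lambda>\<sigma>. - f \<sigma>) x = osc f x" by (simp add: osc_def comp_def)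
qed

lemma osc_affine_le:
  assumes "bounded (range f)" "0 \<le> c"
  shows "osc (\<lambda>\<sigma>. c * f \<sigma> - b) x \<le> c * osc f x"
proof (rule osc_le)
  fix \<sigma>
  have "c * (f (flip x \<sigma>) - f \<sigma>) \<le> c * osc f x" using assms by (intro mult_left_mono le_osc)
  then show "c * f (flip x \<sigma>) - b - (c * f \<sigma> - b) \<le> c * osc f x" by (simp add: right_diff_distrib)
qed


section \<open>Norms\<close>

lemma lp_norm_2_sq:
  assumes "(\<lambda>x. (u x)\<^sup>2) summable_on UNIV"
  shows "(lp_norm 2 u)\<^sup>2 = ereal (\<Sum>\<^sub>\<infinity>x. (u x)\<^sup>2)"
  using assms by (simp add: lp_norm_def powr_half_sqrt infsum_nonneg)

lemma lp_norm_2_infinite: "\<not> (\<lambda>x. (u x)\<^sup>2) summable_on UNIV \<Longrightarrow> lp_norm 2 u = \<infinity>"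
  by (simp add: lp_norm_def)

lemma lp_norm_1: "(\<lambda>x. \<bar>u x\<bar>) summable_on UNIV \<Longrightarrow> lp_norm 1 u = ereal (\<Sum>\<^sub>\<infinity>x. \<bar>u x\<bar>)"
  by (simp add: lp_norm_def infsum_nonneg)

lemma lp_norm_1_infinite: "\<not> (\<lambda>x. \<bar>u x\<bar>) summable_on UNIV \<Longrightarrow> lp_norm 1 u = \<infinity>"
  by (simp add: lp_norm_def)

lemma lp_norm_2_sq_finite_support:
  assumes "finite \<Lambda>" "\<And>x. x \<notin> \<Lambda> \<Longrightarrow> u x = 0"
  shows "(lp_norm 2 u)\<^sup>2 = ereal (\<Sum>x\<in>\<Lambda>. (u x)\<^sup>2)"
proof -
  have "(\<lambda>x. (u x)\<^sup>2) summable_on UNIV \<longleftrightarrow> (\<lambda>x. (u x)\<^sup>2) summable_on \<Lambda>"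
    by (rule summable_on_cong_neutral) (use assms in auto)
  moreover have "(\<Sum>\<^sub>\<infinity>x. (u x)\<^sup>2) = (\<Sum>\<^sub>\<infinity>x\<in>\<Lambda>. (u x)\<^sup>2)"
    by (rule infsum_cong_neutral) (use assms in auto)
  ultimately show ?thesis using assms(1) by (simp add: lp_norm_2_sq)
qed

text \<open>A norm at most 1 is finite, which forces summability; partial sums of nonnegative terms
  then lie below the full sum.\<close>

lemma lp_norm_le_1_sum:
  assumes "finite \<Lambda>" "\<And>x. 0 \<le> u x"
  shows "lp_norm 1 u \<le> 1 \<Longrightarrow> (\<Sum>x\<in>\<Lambda>. u x) \<le> 1"
    and "lp_norm 2 u \<le> 1 \<Longrightarrow> (\<Sum>x\<in>\<Lambda>. (u x)\<^sup>2) \<le> 1"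
proof -
  assume *: "lp_norm 1 u \<le> 1"
  then have s: "(\<lambda>x. \<bar>u x\<bar>) summable_on UNIV" by (rule contrapos_pp) (simp add: lp_norm_1_infinite)
  have "(\<Sum>x\<in>\<Lambda>. \<bar>u x\<bar>) \<le> (\<Sum>\<^sub>\<infinity>x. \<bar>u x\<bar>)" using assms by (intro finite_sum_le_infsum s) auto
  with * show "(\<Sum>x\<in>\<Lambda>. u x) \<le> 1" using assms(2) by (simp add: lp_norm_1[OF s] one_ereal_def)
next
  assume *: "lp_norm 2 u \<le> 1"
  then have s: "(\<lambda>x. (u x)\<^sup>2) summable_on UNIV" by (rule contrapos_pp) (simp add: lp_norm_2_infinite)
  have "(\<Sum>x\<in>\<Lambda>. (u x)\<^sup>2) \<le> (\<Sum>\<^sub>\<infinity>x. (u x)\<^sup>2)" using assms by (intro finite_sum_le_infsum s) auto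
  moreover have "(\<Sum>\<^sub>\<infinity>x. (u x)\<^sup>2) \<le> 1"
    using * s by (simp add: lp_norm_def one_ereal_def powr_half_sqrt infsum_nonneg)
  ultimately show "(\<Sum>x\<in>\<Lambda>. (u x)\<^sup>2) \<le> 1" by simp
qed

section \<open>Young's convolution inequality for finite kernels\<close>

text \<open>Cauchy-Schwarz with weights u bounds the square of the inner sum by (sum of u) times
  (sum of w^2 u); summing over x first leaves the column bound A. A general kernel serves both
  \<psi> and the indicator kernel of block sums.\<close>

lemma sum_kernel_sq_le_l1:
  fixes w :: "'a \<Rightarrow> 'b \<Rightarrow> real"
  assumes w: "\<And>y. y \<in> S \<Longrightarrow> (\<Sum>x\<in>T. (w x y)\<^sup>2) \<le> A" and u: "\<And>y. 0 \<le> u y"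
  shows "(\<Sum>x\<in>T. (\<Sum>y\<in>S. w x y * u y)\<^sup>2) \<le> A * (\<Sum>y\<in>S. u y)\<^sup>2"
proof -
  let ?U = "\<Sum>y\<in>S. u y"
  have "(\<Sum>y\<in>S. w x y * u y)\<^sup>2 \<le> ?U * (\<Sum>y\<in>S. (w x y)\<^sup>2 * u y)" for x
  proof -
    have e: "sqrt (u y) * (w x y * sqrt (u y)) = w x y * u y" for y
      using real_sqrt_mult_self[of "u y"] u[of y] by (simp add: mult.left_commute)
    then show ?thesis
      using Cauchy_Schwarz_ineq_sum[of "\<lambda>y. sqrt (u y)" "\<lambda>y. w x y * sqrt (u y)" S] u
      by (simp add: power_mult_distrib e)
  qed
  then have "(\<Sum>x\<in>T. (\<Sum>y\<in>S. w x y * u y)\<^sup>2) \<le> (\<Sum>x\<in>T. ?U * (\<Sum>y\<in>S. (w x y)\<^sup>2 * u y))"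
    by (rule sum_mono)
  also have "\<dots> = ?U * (\<Sum>x\<in>T. \<Sum>y\<in>S. (w x y)\<^sup>2 * u y)" by (rule sum_distrib_left[symmetric])
  also have "(\<Sum>x\<in>T. \<Sum>y\<in>S. (w x y)\<^sup>2 * u y) = (\<Sum>y\<in>S. (\<Sum>x\<in>T. (w x y)\<^sup>2) * u y)"
    by (subst sum.swap) (simp add: sum_distrib_right)
  also have "?U * (\<Sum>y\<in>S. (\<Sum>x\<in>T. (w x y)\<^sup>2) * u y) \<le> ?U * (\<Sum>y\<in>S. A * u y)"
    using u w by (intro mult_left_mono sum_mono mult_right_mono sum_nonneg)
  also have "\<dots> = A * ?U\<^sup>2" by (simp add: power2_eq_square flip: sum_distrib_left)
  finally show ?thesis .
qed

text \<open>Schur's test: w is split into two square roots in Cauchy-Schwarz, one factor giving row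
  sums and the other, after exchanging sums, column sums.\<close>

lemma sum_kernel_sq_le_l2:
  fixes w :: "'a \<Rightarrow> 'b \<Rightarrow> real"
  assumes w: "\<And>x y. 0 \<le> w x y" and wT: "\<And>y. y \<in> S \<Longrightarrow> (\<Sum>x\<in>T. w x y) \<le> B"
    and wS: "\<And>x. (\<Sum>y\<in>S. w x y) \<le> B" and B: "0 \<le> B"
  shows "(\<Sum>x\<in>T. (\<Sum>y\<in>S. w x y * u y)\<^sup>2) \<le> B\<^sup>2 * (\<Sum>y\<in>S. (u y)\<^sup>2)"
proof -
  have "(\<Sum>y\<in>S. w x y * u y)\<^sup>2 \<le> (\<Sum>y\<in>S. w x y) * (\<Sum>y\<in>S. w x y * (u y)\<^sup>2)" for x
    using Cauchy_Schwarz_ineq_sum[of "\<lambda>y. sqrt (w x y)" "\<lambda>y. sqrt (w x y) * u y" S] w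
    by (simp add: power_mult_distrib flip: mult.assoc)
  also have "\<dots> x \<le> B * (\<Sum>y\<in>S. w x y * (u y)\<^sup>2)" for x
    using w wS by (intro mult_right_mono sum_nonneg) auto
  finally have "(\<Sum>x\<in>T. (\<Sum>y\<in>S. w x y * u y)\<^sup>2) \<le> (\<Sum>x\<in>T. B * (\<Sum>y\<in>S. w x y * (u y)\<^sup>2))"
    by (rule sum_mono)
  also have "\<dots> = B * (\<Sum>y\<in>S. (\<Sum>x\<in>T. w x y) * (u y)\<^sup>2)"
    by (simp only: sum_distrib_left[symmetric] sum_distrib_right sum.swap[of _ T S])
  also have "\<dots> \<le> B * (\<Sum>y\<in>S. B * (u y)\<^sup>2)"
    using B wT by (intro mult_left_mono sum_mono mult_right_mono) auto
  also have "\<dots> = B\<^sup>2 * (\<Sum>y\<in>S. (u y)\<^sup>2)" by (simp add: power2_eq_square sum_distrib_left mult.assoc)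
  finally show ?thesis .
qed

text \<open>Supplies the row and column bounds of a convolution kernel: shifts and reflections are
  injective, so these are partial sums of v.\<close>

lemma sum_translates_le_infsum:
  fixes v :: "('d::finite) site \<Rightarrow> real"
  assumes "v summable_on UNIV" "\<And>x. 0 \<le> v x" "finite T"
  shows "(\<Sum>x\<in>T. v (x - y)) \<le> infsum v UNIV" "(\<Sum>x\<in>T. v (y - x)) \<le> infsum v UNIV"
proof -
  have "(\<Sum>x\<in>T. v (x - y)) = sum v ((\<lambda>x. x - y) ` T)" "(\<Sum>x\<in>T. v (y - x)) = sum v ((\<lambda>x. y - x) ` T)"
    by (simp_all add: sum.reindex inj_on_def)
  then show "(\<Sum>x\<in>T. v (x - y)) \<le> infsum v UNIV" "(\<Sum>x\<in>T. v (y - x)) \<le> infsum v UNIV"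
    using assms by (auto intro!: finite_sum_le_infsum)
qed


section \<open>The transport inequality\<close>

lemma le_sqrt_of_quadratic_bound:
  fixes s C Q \<Delta> :: real
  assumes "\<And>t. 0 \<le> t \<Longrightarrow> t * \<Delta> \<le> s + C / 2 * (t\<^sup>2 * Q)" "0 < C" "0 \<le> Q" "0 \<le> s"
  shows "\<Delta> \<le> sqrt (2 * C * s * Q)"
proof (cases "\<Delta> \<le> 0")
  case True
  moreover have "0 \<le> sqrt (2 * C * s * Q)" using assms by simp
  ultimately show ?thesis by linarith
next
  case False
  show ?thesis
  proof (cases "Q = 0")
    case True
    \<comment> \<open>With Q = 0 this choice of t turns the hypothesis into s + 1 \<le> s.\<close>
    with assms(1)[of "(s + 1) / \<Delta>"] False assms(4) show ?thesis by simp
  next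
    case Q: False
    \<comment> \<open>The chosen t minimises s - t \<Delta> + C Q t^2 / 2.\<close>
    with assms(1)[of "\<Delta> / (C * Q)"] assms False have "\<Delta>\<^sup>2 / (C * Q) \<le> s + \<Delta>\<^sup>2 / (2 * (C * Q))"
      by (simp add: power2_eq_square)
    then have "\<Delta>\<^sup>2 / (2 * (C * Q)) \<le> s" by (simp add: field_simps)
    then have "\<Delta>\<^sup>2 \<le> 2 * C * s * Q" using assms Q by (simp add: field_simps)
    then show ?thesis by (rule real_le_rsqrt)
  qed
qed

text \<open>The Gibbs inequality bounds the \<nu>-integral of a test function by entropy plus a
  logarithmic moment under \<mu>, and \<open>GCB\<close> bounds that moment quadratically in the
  scale t.\<close>

lemma transport_inequality:
  fixes \<mu> \<nu> :: "('d::finite) config measure"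
  assumes \<mu>: "probability_on_configs \<mu>" and fe: "finite_energy \<rho> \<mu>" and gcb: "GCB C \<mu>" and C: "0 < C"
    and \<nu>: "probability_on_configs \<nu>" and \<Lambda>: "finite \<Lambda>" and g: "depends_on \<Lambda> g"
  shows "(\<integral>\<sigma>. g \<sigma> \<partial>\<nu>) - (\<integral>\<sigma>. g \<sigma> \<partial>\<mu>)
    \<le> sqrt (2 * C * local_entropy \<Lambda> \<nu> \<mu> * (\<Sum>x\<in>\<Lambda>. (osc g x)\<^sup>2))"
proof (rule le_sqrt_of_quadratic_bound)
  let ?m = "\<integral>\<sigma>. g \<sigma> \<partial>\<mu>" and ?Q = "\<Sum>x\<in>\<Lambda>. (osc g x)\<^sup>2"
  interpret \<mu>: prob_space \<mu> using \<mu> by (rule probability_on_configsD)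
  interpret \<nu>: prob_space \<nu> using \<nu> by (rule probability_on_configsD)
  have b: "bounded (range g)" by (rule bounded_depends_on[OF \<Lambda> g])
  fix t :: real assume t: "0 \<le> t"
  \<comment> \<open>Centred under \<mu>, so that the exponent in \<open>GCB\<close> is h
    itself.\<close>
  define h where "h = (\<lambda>\<sigma>. t * g \<sigma> - t * ?m)"
  have h: "depends_on \<Lambda> h" unfolding h_def by (rule depends_on_compose[OF g])
  have int: "integrable \<mu> g" "integrable \<nu> g" using depends_on_integrable \<mu> \<nu> \<Lambda> g by auto
  have h0: "(\<integral>\<sigma>. h \<sigma> \<partial>\<mu>) = 0" unfolding h_def using int by (simp add: \<mu>.prob_space)
  have "ereal (ln (\<integral>\<sigma>. exp (h \<sigma> - (\<integral>\<tau>. h \<tau> \<partial>\<mu>)) \<partial>\<mu>)) \<le> ereal (C / 2) * (lp_norm 2 (osc h))\<^sup>2"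
    using gcb h \<Lambda> unfolding GCB_def is_local_iff by blast
  also have "(lp_norm 2 (osc h))\<^sup>2 = ereal (\<Sum>x\<in>\<Lambda>. (osc h x)\<^sup>2)"
    by (rule lp_norm_2_sq_finite_support[OF \<Lambda> osc_eq_0[OF h]])
  finally have "ln (\<integral>\<sigma>. exp (h \<sigma>) \<partial>\<mu>) \<le> C / 2 * (\<Sum>x\<in>\<Lambda>. (osc h x)\<^sup>2)"
    unfolding h0 by simp
  also have "\<dots> \<le> C / 2 * (\<Sum>x\<in>\<Lambda>. (t * osc g x)\<^sup>2)"
    using C t b osc_nonneg[OF bounded_depends_on[OF \<Lambda> h]] osc_affine_le[OF b t]
    by (intro mult_left_mono sum_mono power_mono) (auto simp: h_def)
  also have "(\<Sum>x\<in>\<Lambda>. (t * osc g x)\<^sup>2) = t\<^sup>2 * ?Q" by (simp add: power_mult_distrib sum_distrib_left)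
  finally have "ln (\<integral>\<sigma>. exp (h \<sigma>) \<partial>\<mu>) \<le> C / 2 * (t\<^sup>2 * ?Q)" .
  moreover have "(\<integral>\<sigma>. h \<sigma> \<partial>\<nu>) = t * ((\<integral>\<sigma>. g \<sigma> \<partial>\<nu>) - ?m)"
    unfolding h_def using int by (simp add: \<nu>.prob_space right_diff_distrib)
  ultimately show "t * ((\<integral>\<sigma>. g \<sigma> \<partial>\<nu>) - ?m) \<le> local_entropy \<Lambda> \<nu> \<mu> + C / 2 * (t\<^sup>2 * ?Q)"
    using gibbs_inequality[OF \<mu> fe \<nu> \<Lambda> h] by simp
next
  show "0 \<le> (\<Sum>x\<in>\<Lambda>. (osc g x)\<^sup>2)" by (simp add: sum_nonneg)
  show "0 \<le> local_entropy \<Lambda> \<nu> \<mu>" by (rule local_entropy_nonneg[OF \<mu> fe \<nu> \<Lambda>])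
qed (rule C)

section \<open>Iterates of the automaton\<close>

lemma depends_on_pca_iterate:
  fixes f :: "('d::finite) config \<Rightarrow> real"
  assumes "local_with_speed r a" "depends_on (cube n) f" "finite (cube n :: 'd site set)"
    "finite (cube (n + a * k) :: 'd site set)"
  shows "depends_on (cube (n + a * k)) ((pca_op r ^^ k) f)"
  using assms measurable_spin_algebra_iff unfolding local_with_speed_def by blast

text \<open>Duality between the actions on measures and on functions. Locality of f supplies the
  measurability and boundedness required for integrating against a bind.\<close>

lemma integral_pca_step:
  fixes f :: "('d::finite) config \<Rightarrow> real"
  assumes r: "is_pca r" and \<nu>: "probability_on_configs \<nu>" and \<Lambda>: "finite \<Lambda>" and f: "depends_on \<Lambda> f"
  shows "(\<integral>\<sigma>. f \<sigma> \<partial>pca_step r \<nu>) = (\<integral>\<eta>. pca_op r f \<eta> \<partial>\<nu>)"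
proof -
  interpret prob_space \<nu> using \<nu> by (rule probability_on_configsD)
  obtain B where B: "\<And>\<sigma>. \<bar>f \<sigma>\<bar> \<le> B"
    using bounded_depends_on[OF \<Lambda> f] unfolding bounded_iff by auto
  have k: "pca_kernel r \<in> \<nu> \<rightarrow>\<^sub>M subprob_algebra borel"
    using measurable_prob_algebraD[OF pca_kernel_measurable[OF r]] probability_on_configsD(2)[OF \<nu>]
    by (simp cong: measurable_cong_sets)
  have "emeasure (pca_kernel r \<eta>) (space (pca_kernel r \<eta>)) \<le> ennreal 1" for \<eta>
    by (simp add: prob_space.emeasure_space_1[OF prob_space_pca_kernel])
  then show ?thesis unfolding pca_step_def pca_op_def
    using B by (intro integral_bind[OF depends_on_borel_measurable[OF \<Lambda> f] _ k finite_measure_axioms] AE_I2)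
qed

lemma probability_on_configs_pca_iterate:
  "is_pca r \<Longrightarrow> probability_on_configs \<nu> \<Longrightarrow> probability_on_configs ((pca_step r ^^ k) \<nu>)"
  by (induction k) (simp_all add: probability_on_configs_pca_step)

lemma finite_cube [simp]: "finite (cube n :: ('d::finite) site set)"
  and card_cube: "card (cube n :: ('d::finite) site set) = (2 * n + 1) ^ CARD('d)"
proof -
  have eq: "(cube n :: 'd site set) = vec_lambda ` (UNIV \<rightarrow>\<^sub>E {- int n..int n})"
  proof (intro set_eqI iffI)
    fix x :: "'d site" assume "x \<in> cube n"
    then have "vec_nth x \<in> UNIV \<rightarrow>\<^sub>E {- int n..int n}" by (auto simp: cube_def)
    then show "x \<in> vec_lambda ` (UNIV \<rightarrow>\<^sub>E {- int n..int n})" by (rule rev_image_eqI) simp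
  qed (auto simp: cube_def PiE_iff)
  show "finite (cube n :: 'd site set)" unfolding eq by (intro finite_imageI finite_PiE) auto
  have "inj_on (vec_lambda :: ('d \<Rightarrow> int) \<Rightarrow> 'd site) (UNIV \<rightarrow>\<^sub>E {- int n..int n})"
    by (intro inj_onI) (metis vec_lambda_inverse UNIV_I)
  then show "card (cube n :: 'd site set) = (2 * n + 1) ^ CARD('d)"
    unfolding eq by (simp add: card_image card_PiE) (simp add: nat_add_distrib nat_mult_distrib)
qed

text \<open>The induction peels off the step acting directly on \<nu>, hence the generalisation over
  \<nu>. Locality of the automaton keeps the iterated function local, so one-step duality applies to
  it.\<close>

lemma integral_pca_iterate:
  fixes f :: "('d::finite) config \<Rightarrow> real"
  assumes r: "is_pca r" "local_with_speed r a" and \<nu>: "probability_on_configs \<nu>" and f: "depends_on (cube n) f"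
  shows "(\<integral>\<sigma>. f \<sigma> \<partial>(pca_step r ^^ k) \<nu>) = (\<integral>\<eta>. (pca_op r ^^ k) f \<eta> \<partial>\<nu>)"
  using \<nu>
proof (induction k arbitrary: \<nu>)
  case (Suc k)
  then have "(\<integral>\<sigma>. f \<sigma> \<partial>(pca_step r ^^ k) (pca_step r \<nu>)) = (\<integral>\<eta>. (pca_op r ^^ k) f \<eta> \<partial>pca_step r \<nu>)"
    using probability_on_configs_pca_step r by blast
  also have "\<dots> = (\<integral>\<eta>. (pca_op r ^^ Suc k) f \<eta> \<partial>\<nu>)"
    using integral_pca_step[OF r(1) Suc.prems _ depends_on_pca_iterate[OF r(2) f]] by simp
  finally show ?case by (simp add: funpow_swap1)
qed simp

text \<open>Oscillations of f vanish outside \<Lambda>, which truncates the convolution to a finite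
  sum.\<close>

lemma osc_pca_iterate_le:
  fixes f :: "('d::finite) config \<Rightarrow> real"
  assumes "contraction_speed r \<psi>" and \<Lambda>: "finite \<Lambda>" and f: "depends_on \<Lambda> f"
  shows "osc ((pca_op r ^^ k) f) x \<le> (\<Sum>y\<in>\<Lambda>. \<psi> k (x - y) * osc f y)"
proof -
  have "osc ((pca_op r ^^ k) f) x \<le> (\<Sum>\<^sub>\<infinity>y. \<psi> k (x - y) * osc f y)"
    using assms unfolding contraction_speed_def is_local_iff by blast
  also have "\<dots> = (\<Sum>\<^sub>\<infinity>y\<in>\<Lambda>. \<psi> k (x - y) * osc f y)"
    by (rule infsum_cong_neutral) (auto simp: osc_eq_0[OF f])
  finally show ?thesis using \<Lambda> by simp
qed

section \<open>Translation equivariance of the dynamics\<close>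

lemma translate_measurable: "translate x \<in> (borel :: ('d::finite) config measure) \<rightarrow>\<^sub>M borel"
proof -
  have "continuous_on UNIV (translate x :: 'd config \<Rightarrow> 'd config)" unfolding translate_def
    by (intro continuous_on_coordinatewise_then_product continuous_on_product_coordinates)
  then show ?thesis by (rule borel_measurable_continuous_onI)
qed

lemma pca_field_translate: "pca_field r x (translate z \<eta>) = pca_field r (x + z) \<eta>"
proof -
  have "(\<Prod>y\<in>(\<lambda>a. a + x) ` A. spin (translate z \<eta> y)) = (\<Prod>y\<in>(\<lambda>a. a + (x + z)) ` A. spin (\<eta> y))" for A
    by (simp add: prod.reindex inj_on_def translate_def add.assoc)
  then show ?thesis by (simp add: pca_field_def)
qed

text \<open>Translating the conditioning configuration shifts the marginals, and a product measure
  with shifted factors is the image of the original one under the shift of coordinates.\<close>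

lemma pca_kernel_translate: "pca_kernel r (translate z \<eta>) = distr (pca_kernel r \<eta>) borel (translate z)"
proof -
  let ?M = "\<lambda>x. measure_pmf (bernoulli_pmf ((1 + pca_field r x \<eta>) / 2))"
  have "pca_kernel r (translate z \<eta>) = PiM UNIV (\<lambda>x. ?M (x + z))"
    by (simp add: pca_kernel_def pca_field_translate)
  also have "\<dots> = distr (PiM UNIV ?M) (PiM UNIV (\<lambda>x. ?M (x + z))) (\<lambda>\<omega>. \<lambda>n\<in>UNIV. \<omega> (n + z))"
    by (rule distr_PiM_reindex[symmetric]) (auto simp: inj_on_def measure_pmf.prob_space_axioms)
  also have "\<dots> = distr (pca_kernel r \<eta>) borel (translate z)"
    unfolding pca_kernel_def
    by (rule distr_cong) (auto simp: translate_def sets_PiM_spins)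
  finally show ?thesis .
qed

lemma translation_invariant_pca_step:
  fixes \<nu> :: "('d::finite) config measure"
  assumes r: "is_pca r" and \<nu>: "probability_on_configs \<nu>" and ti: "translation_invariant \<nu>"
  shows "translation_invariant (pca_step r \<nu>)"
  unfolding translation_invariant_def
proof
  fix z :: "'d site"
  have s: "sets (pca_step r \<nu>) = sets borel" "space (pca_step r \<nu>) = UNIV"
    using probability_on_configsD[OF probability_on_configs_pca_step[OF r \<nu>]] by auto
  have tm: "translate z \<in> \<nu> \<rightarrow>\<^sub>M borel" "translate z \<in> pca_step r \<nu> \<rightarrow>\<^sub>M borel"
    "translate z \<in> pca_kernel r \<eta> \<rightarrow>\<^sub>M borel" for \<eta>
    using translate_measurable[of z] probability_on_configsD(2)[OF \<nu>] s(1) sets_pca_kernel[of r \<eta>]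
    by (simp_all cong: measurable_cong_sets)
  have sk: "space (pca_kernel r \<eta>) = UNIV" for \<eta> :: "'d config"
    using sets_eq_imp_space_eq[OF sets_pca_kernel[of r \<eta>]] by simp
  show "distr (pca_step r \<nu>) borel (translate z) = pca_step r \<nu>"
  proof (rule measure_eqI)
    fix A assume "A \<in> sets (distr (pca_step r \<nu>) borel (translate z))"
    then have A: "A \<in> sets borel" by simp
    have tA: "translate z -` A \<in> sets borel" using measurable_sets[OF translate_measurable[of z] A] by simp
    have Am: "(\<lambda>\<eta>. emeasure (pca_kernel r \<eta>) A) \<in> borel_measurable borel"
      by (rule measurable_emeasure_kernel[OF measurable_prob_algebraD[OF pca_kernel_measurable[OF r]] A])
    have "emeasure (distr (pca_step r \<nu>) borel (translate z)) A = emeasure (pca_step r \<nu>) (translate z -` A)"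
      using emeasure_distr[OF tm(2) A] s by simp
    also have "\<dots> = (\<integral>\<^sup>+\<eta>. emeasure (pca_kernel r \<eta>) (translate z -` A) \<partial>\<nu>)"
      by (rule emeasure_pca_step[OF r \<nu> tA])
    \<comment> \<open>Equivariance moves the translation from the event to the conditioning
      configuration, where the invariance of \<nu> absorbs it.\<close>
    also have "\<dots> = (\<integral>\<^sup>+\<eta>. emeasure (pca_kernel r (translate z \<eta>)) A \<partial>\<nu>)"
      unfolding pca_kernel_translate using emeasure_distr[OF tm(3) A] sk by simp
    also have "\<dots> = (\<integral>\<^sup>+\<eta>. emeasure (pca_kernel r \<eta>) A \<partial>distr \<nu> borel (translate z))"
      by (subst nn_integral_distr[OF tm(1)]) (simp_all add: Am)
    also have "\<dots> = emeasure (pca_step r \<nu>) A"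
      using ti emeasure_pca_step[OF r \<nu> A] by (simp add: translation_invariant_def)
    finally show "emeasure (distr (pca_step r \<nu>) borel (translate z)) A = emeasure (pca_step r \<nu>) A" .
  qed (simp add: s)
qed

lemma translation_invariant_pca_iterate:
  "is_pca r \<Longrightarrow> probability_on_configs \<nu> \<Longrightarrow> translation_invariant \<nu> \<Longrightarrow> translation_invariant ((pca_step r ^^ k) \<nu>)"
  by (induction k) (simp_all add: translation_invariant_pca_step probability_on_configs_pca_iterate)

lemma integral_translate:
  fixes f :: "('d::finite) config \<Rightarrow> real"
  assumes "probability_on_configs \<kappa>" "translation_invariant \<kappa>" "f \<in> borel_measurable borel"
  shows "(\<integral>\<sigma>. f (translate z \<sigma>) \<partial>\<kappa>) = (\<integral>\<sigma>. f \<sigma> \<partial>\<kappa>)"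
proof -
  have "translate z \<in> \<kappa> \<rightarrow>\<^sub>M borel"
    using translate_measurable[of z] probability_on_configsD(2)[OF assms(1)] by (simp cong: measurable_cong_sets)
  from integral_distr[OF this assms(3)] assms(2) show ?thesis by (simp add: translation_invariant_def)
qed

section \<open>Distance bounds\<close>

lemma ereal_power2_mono: "0 \<le> x \<Longrightarrow> x \<le> y \<Longrightarrow> x\<^sup>2 \<le> (y\<^sup>2 :: ereal)"
  by (simp add: power2_eq_square ereal_mult_mono)

lemma square_le_of_le_sqrt:
  fixes x :: ereal
  assumes "0 \<le> x" "x \<le> ereal (sqrt c)" "0 \<le> c"
  shows "x\<^sup>2 \<le> ereal c"
  using ereal_power2_mono[OF assms(1,2)] assms(3) by simp

text \<open>If the norm \<open>N\<close> is infinite and the constant vanishes, the right-hand side is \<open>0 * \<infinity> = 0\<close>, so that case needs its own argument.\<close>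

lemma square_le_times_norm:
  fixes x N :: ereal
  assumes "0 \<le> x" "0 \<le> c" "N = \<infinity> \<or> (\<exists>A\<ge>0. N\<^sup>2 = ereal A)"
    and "\<And>A. 0 \<le> A \<Longrightarrow> N\<^sup>2 = ereal A \<Longrightarrow> x \<le> ereal (sqrt (c * A))" and "c = 0 \<Longrightarrow> x \<le> 0"
  shows "x\<^sup>2 \<le> ereal c * N\<^sup>2"
  using assms(3)
proof
  assume N: "N = \<infinity>"
  show ?thesis
  proof (cases "c = 0")
    case True
    then show ?thesis using assms(1,5) by (simp add: antisym power2_eq_square flip: zero_ereal_def)
  next
    case False
    with assms(2) N show ?thesis by (simp add: power2_eq_square)
  qed
next
  assume "\<exists>A\<ge>0. N\<^sup>2 = ereal A"
  then obtain A where A: "0 \<le> A" "N\<^sup>2 = ereal A" by auto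
  have "x\<^sup>2 \<le> ereal (c * A)"
    using A assms by (intro square_le_of_le_sqrt) auto
  then show ?thesis using A by simp
qed

lemma lp_norm_cases:
  "lp_norm 2 u = \<infinity> \<or> (\<exists>A\<ge>0. (lp_norm 2 u)\<^sup>2 = ereal A)"
  "lp_norm 1 u = \<infinity> \<or> (\<exists>A\<ge>0. (lp_norm 1 u)\<^sup>2 = ereal A)"
  using lp_norm_2_infinite[of u] lp_norm_2_sq[of u] infsum_nonneg[of UNIV "\<lambda>x. (u x)\<^sup>2"]
    lp_norm_1_infinite[of u] lp_norm_1[of u]
  by fastforce+

text \<open>The zero function is an admissible test function. Nonnegativity is what allows bounds on
  the distance to be squared.\<close>

lemma D_inf_nonneg: "0 \<le> D_inf \<Lambda> \<kappa> \<mu>"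
  unfolding D_inf_def by (rule SUP_upper2[of "\<lambda>_. 0"]) (simp_all add: osc_def lp_norm_def)

lemma D_two_nonneg: "0 \<le> D_two \<Lambda> \<kappa> \<mu>"
  unfolding D_two_def by (rule SUP_upper2[of "\<lambda>_. 0"]) (simp_all add: osc_def lp_norm_def)

lemma dbar_nonneg: "0 \<le> dbar \<kappa> \<mu>"
  unfolding dbar_def by (rule SUP_upper2[of "\<lambda>_. 0"]) (simp_all add: osc_def lp_norm_def)

section \<open>Finite-volume bounds for the iterated automaton\<close>

locale gcb_pca =
  fixes r :: "('d::finite) site set \<Rightarrow> real" and \<psi> :: "nat \<Rightarrow> 'd site \<Rightarrow> real" and a :: nat
    and \<mu> :: "'d config measure" and C \<rho> :: real
  assumes pca: "is_pca r" and contraction: "contraction_speed r \<psi>" and local: "local_with_speed r a"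
    and \<mu>: "probability_on_configs \<mu>" and stat: "stationary r \<mu>" and ti: "translation_invariant \<mu>"
    and C: "0 < C" and gcb: "GCB C \<mu>" and \<rho>: "0 < \<rho>" and fe: "finite_energy \<rho> \<mu>"
begin

lemma \<psi>_nonneg: "0 \<le> \<psi> k x"
  using contraction by (simp add: contraction_speed_def)

lemma stationary_iterate: "(pca_step r ^^ k) \<mu> = \<mu>"
  using stat by (induction k) (simp_all add: stationary_def)

lemma entropy_bounds:
  assumes "probability_on_configs \<nu>"
  shows "0 \<le> local_entropy (cube n) \<nu> \<mu>" "local_entropy (cube n) \<nu> \<mu> \<le> \<rho> * card (cube n :: 'd site set)"
  using local_entropy_nonneg[OF \<mu> fe assms finite_cube] local_entropy_le[OF \<mu> fe assms finite_cube] by auto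

text \<open>The transport inequality for the iterated function on the enlarged cube. Q is left open
  so that either form of Young's inequality can supply it.\<close>

lemma iterate_transport:
  assumes \<nu>: "probability_on_configs \<nu>" and f: "depends_on (cube n) f"
    and Q: "(\<Sum>x\<in>cube (n + a * k). (\<Sum>y\<in>cube n. \<psi> k (x - y) * osc f y)\<^sup>2) \<le> Q"
  shows "(\<integral>\<sigma>. f \<sigma> \<partial>(pca_step r ^^ k) \<nu>) - (\<integral>\<sigma>. f \<sigma> \<partial>\<mu>)
    \<le> sqrt (2 * C * local_entropy (cube (n + a * k)) \<nu> \<mu> * Q)"
proof -
  let ?g = "(pca_op r ^^ k) f" and ?\<Lambda> = "cube (n + a * k) :: 'd site set"
  have g: "depends_on ?\<Lambda> ?g" by (rule depends_on_pca_iterate[OF local f]) simp_all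
  \<comment> \<open>Stationarity lets the integral against \<mu> be iterated along with the one
    against \<nu>.\<close>
  have "(\<integral>\<sigma>. f \<sigma> \<partial>\<mu>) = (\<integral>\<sigma>. ?g \<sigma> \<partial>\<mu>)"
    using integral_pca_iterate[OF pca local \<mu> f, of k] by (simp add: stationary_iterate)
  then have "(\<integral>\<sigma>. f \<sigma> \<partial>(pca_step r ^^ k) \<nu>) - (\<integral>\<sigma>. f \<sigma> \<partial>\<mu>)
      \<le> sqrt (2 * C * local_entropy ?\<Lambda> \<nu> \<mu> * (\<Sum>x\<in>?\<Lambda>. (osc ?g x)\<^sup>2))"
    using transport_inequality[OF \<mu> fe gcb C \<nu> finite_cube g] integral_pca_iterate[OF pca local \<nu> f, of k]
    by simp
  also have "(\<Sum>x\<in>?\<Lambda>. (osc ?g x)\<^sup>2) \<le> (\<Sum>x\<in>?\<Lambda>. (\<Sum>y\<in>cube n. \<psi> k (x - y) * osc f y)\<^sup>2)"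
    using osc_pca_iterate_le[OF contraction finite_cube f] osc_nonneg[OF bounded_depends_on[OF finite_cube g]]
    by (intro sum_mono power_mono)
  also note Q
  finally show ?thesis using C entropy_bounds(1)[OF \<nu>] by (simp add: mult_left_mono)
qed

lemma transport_l2_l1:
  assumes \<nu>: "probability_on_configs \<nu>" and f: "depends_on (cube n) f"
    and A: "(lp_norm 2 (\<psi> k))\<^sup>2 = ereal A" and osc: "(\<Sum>y\<in>cube n. osc f y) \<le> 1"
  shows "(\<integral>\<sigma>. f \<sigma> \<partial>(pca_step r ^^ k) \<nu>) - (\<integral>\<sigma>. f \<sigma> \<partial>\<mu>)
    \<le> sqrt (2 * C * local_entropy (cube (n + a * k)) \<nu> \<mu> * A)"
proof (rule iterate_transport[OF \<nu> f])
  \<comment> \<open>Without summability the norm, and hence its square, would be \<infinity> and not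
    the real A.\<close>
  have s: "(\<lambda>x. (\<psi> k x)\<^sup>2) summable_on UNIV"
    by (rule ccontr) (use A lp_norm_2_infinite[of "\<psi> k"] in \<open>simp add: power2_eq_square\<close>)
  then have A': "A = (\<Sum>\<^sub>\<infinity>x. (\<psi> k x)\<^sup>2)" using A lp_norm_2_sq[OF s] by simp
  have o: "0 \<le> osc f y" for y by (rule osc_nonneg[OF bounded_depends_on[OF finite_cube f]])
  have "(\<Sum>x\<in>cube (n + a * k). (\<Sum>y\<in>cube n. \<psi> k (x - y) * osc f y)\<^sup>2) \<le> A * (\<Sum>y\<in>cube n. osc f y)\<^sup>2"
    using sum_translates_le_infsum(1)[OF s] o by (intro sum_kernel_sq_le_l1) (auto simp: A')
  also have "\<dots> \<le> A * 1"
    using osc o by (intro mult_left_mono power_le_one sum_nonneg) (auto simp: A' infsum_nonneg)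
  finally show "(\<Sum>x\<in>cube (n + a * k). (\<Sum>y\<in>cube n. \<psi> k (x - y) * osc f y)\<^sup>2) \<le> A" by simp
qed

text \<open>The bound b is kept general: it is 1 for \<open>D_two\<close>, but the volume of a cube
  for block sums.\<close>

lemma transport_l1_l2:
  assumes \<nu>: "probability_on_configs \<nu>" and f: "depends_on (cube n) f"
    and A: "(lp_norm 1 (\<psi> k))\<^sup>2 = ereal A" and osc: "(\<Sum>y\<in>cube n. (osc f y)\<^sup>2) \<le> b"
  shows "(\<integral>\<sigma>. f \<sigma> \<partial>(pca_step r ^^ k) \<nu>) - (\<integral>\<sigma>. f \<sigma> \<partial>\<mu>)
    \<le> sqrt (2 * C * local_entropy (cube (n + a * k)) \<nu> \<mu> * (A * b))"
proof (rule iterate_transport[OF \<nu> f])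
  define B where "B = (\<Sum>\<^sub>\<infinity>x. \<psi> k x)"
  have s: "\<psi> k summable_on UNIV"
    by (rule ccontr) (use A lp_norm_1_infinite[of "\<psi> k"] \<psi>_nonneg in \<open>simp add: power2_eq_square\<close>)
  then have A': "A = B\<^sup>2" using A lp_norm_1[of "\<psi> k"] \<psi>_nonneg by (simp add: B_def)
  have "0 \<le> B" unfolding B_def by (intro infsum_nonneg \<psi>_nonneg)
  then have "(\<Sum>x\<in>cube (n + a * k). (\<Sum>y\<in>cube n. \<psi> k (x - y) * osc f y)\<^sup>2) \<le> B\<^sup>2 * (\<Sum>y\<in>cube n. (osc f y)\<^sup>2)"
    using sum_translates_le_infsum[OF s \<psi>_nonneg] \<psi>_nonneg by (intro sum_kernel_sq_le_l2) (auto simp: B_def)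
  also have "\<dots> \<le> A * b" using osc by (simp add: A' mult_left_mono)
  finally show "(\<Sum>x\<in>cube (n + a * k). (\<Sum>y\<in>cube n. \<psi> k (x - y) * osc f y)\<^sup>2) \<le> A * b" .
qed

text \<open>Q can be the finite convolution sum itself, so the conclusion also holds when the norm
  of \<psi> is infinite, where the product 0 * \<infinity> = 0 has to be handled.\<close>

lemma transport_zero_entropy:
  fixes f :: "'d config \<Rightarrow> real"
  assumes "probability_on_configs \<nu>" "depends_on (cube n) f" "local_entropy (cube (n + a * k)) \<nu> \<mu> = 0"
  shows "(\<integral>\<sigma>. f \<sigma> \<partial>(pca_step r ^^ k) \<nu>) \<le> (\<integral>\<sigma>. f \<sigma> \<partial>\<mu>)"
  using iterate_transport[OF assms(1,2) order_refl, of k] assms(3) by simp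

lemma D_inf_iterate_le:
  assumes \<nu>: "probability_on_configs \<nu>"
  shows "(D_inf (cube n) ((pca_step r ^^ k) \<nu>) \<mu>)\<^sup>2
    \<le> ereal (2 * C * local_entropy (cube (n + a * k)) \<nu> \<mu>) * (lp_norm 2 (\<psi> k))\<^sup>2"
proof (rule square_le_times_norm[OF D_inf_nonneg _ lp_norm_cases(1)])
  have f: "depends_on (cube n) f" "(\<Sum>y\<in>cube n. osc f y) \<le> 1"
    if "f \<in> borel_measurable (spin_algebra (cube n))" "lp_norm 1 (osc f) \<le> 1" for f :: "'d config \<Rightarrow> real"
  proof -
    show d: "depends_on (cube n) f" using that(1) by (simp add: measurable_spin_algebra_iff)
    show "(\<Sum>y\<in>cube n. osc f y) \<le> 1"
      using that(2) osc_nonneg[OF bounded_depends_on[OF finite_cube d]] by (intro lp_norm_le_1_sum) auto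
  qed
  show "0 \<le> 2 * C * local_entropy (cube (n + a * k)) \<nu> \<mu>" using C entropy_bounds(1)[OF \<nu>] by simp
  show "D_inf (cube n) ((pca_step r ^^ k) \<nu>) \<mu> \<le> ereal (sqrt (2 * C * local_entropy (cube (n + a * k)) \<nu> \<mu> * A))"
    if "(lp_norm 2 (\<psi> k))\<^sup>2 = ereal A" for A
    unfolding D_inf_def using f transport_l2_l1[OF \<nu> _ that] by (intro SUP_least) auto
  show "D_inf (cube n) ((pca_step r ^^ k) \<nu>) \<mu> \<le> 0" if "2 * C * local_entropy (cube (n + a * k)) \<nu> \<mu> = 0"
    unfolding D_inf_def using f transport_zero_entropy[OF \<nu>, where n = n and k = k] C that by (intro SUP_least) auto
qed

lemma D_two_iterate_le:
  assumes \<nu>: "probability_on_configs \<nu>"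
  shows "(D_two (cube n) ((pca_step r ^^ k) \<nu>) \<mu>)\<^sup>2
    \<le> ereal (2 * C * local_entropy (cube (n + a * k)) \<nu> \<mu>) * (lp_norm 1 (\<psi> k))\<^sup>2"
proof (rule square_le_times_norm[OF D_two_nonneg _ lp_norm_cases(2)])
  have f: "depends_on (cube n) f" "(\<Sum>y\<in>cube n. (osc f y)\<^sup>2) \<le> 1"
    if "f \<in> borel_measurable (spin_algebra (cube n))" "lp_norm 2 (osc f) \<le> 1" for f :: "'d config \<Rightarrow> real"
  proof -
    show d: "depends_on (cube n) f" using that(1) by (simp add: measurable_spin_algebra_iff)
    show "(\<Sum>y\<in>cube n. (osc f y)\<^sup>2) \<le> 1"
      using that(2) osc_nonneg[OF bounded_depends_on[OF finite_cube d]] by (intro lp_norm_le_1_sum) auto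
  qed
  show "0 \<le> 2 * C * local_entropy (cube (n + a * k)) \<nu> \<mu>" using C entropy_bounds(1)[OF \<nu>] by simp
  show "D_two (cube n) ((pca_step r ^^ k) \<nu>) \<mu> \<le> ereal (sqrt (2 * C * local_entropy (cube (n + a * k)) \<nu> \<mu> * A))"
    if "(lp_norm 1 (\<psi> k))\<^sup>2 = ereal A" for A
    unfolding D_two_def using f transport_l1_l2[OF \<nu> _ that, of _ _ 1] by (intro SUP_least) auto
  show "D_two (cube n) ((pca_step r ^^ k) \<nu>) \<mu> \<le> 0" if "2 * C * local_entropy (cube (n + a * k)) \<nu> \<mu> = 0"
    unfolding D_two_def using f transport_zero_entropy[OF \<nu>, where n = n and k = k] C that by (intro SUP_least) auto
qed

end

section \<open>The distance in infinite volume\<close>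

definition block_sum :: "nat \<Rightarrow> (('d::finite) config \<Rightarrow> real) \<Rightarrow> 'd config \<Rightarrow> real" where
  "block_sum N f \<sigma> = (\<Sum>z\<in>cube N. f (translate z \<sigma>))"

lemma depends_on_block_sum:
  assumes "depends_on (cube m) f"
  shows "depends_on (cube (m + N)) (block_sum N f)"
  unfolding depends_on_def
proof (intro allI impI)
  fix \<sigma> \<tau> :: "'a config" assume eq: "\<forall>x\<in>cube (m + N). \<sigma> x = \<tau> x"
  have "y + z \<in> cube (m + N)" if "y \<in> cube m" "z \<in> cube N" for y z :: "'a site"
    using that by (simp add: cube_def) (smt (verit))
  then show "block_sum N f \<sigma> = block_sum N f \<tau>"
    unfolding block_sum_def using eq
    by (intro sum.cong depends_onD[OF assms]) (auto simp: translate_def)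
qed

lemma translate_flip: "translate z (flip x \<sigma>) = flip (x - z) (translate z \<sigma>)"
  by (auto simp: translate_def flip_def fun_eq_iff algebra_simps)

text \<open>A flip at x is seen by the translate by z as a flip at x - z. The resulting sum is the
  convolution of the oscillations of f with the indicator of the cube.\<close>

lemma osc_block_sum_le:
  assumes "depends_on (cube m) f"
  shows "osc (block_sum N f) x \<le> (\<Sum>y\<in>cube m. indicator (cube N) (x - y) * osc f y)"
proof -
  have b: "bounded (range f)" by (rule bounded_depends_on[OF finite_cube assms])
  have "osc (block_sum N f) x \<le> (\<Sum>z\<in>cube N. osc f (x - z))"
    using le_osc[OF b]
    by (intro osc_le) (auto simp: block_sum_def translate_flip simp flip: sum_subtractf intro!: sum_mono)
  also have "\<dots> = (\<Sum>y\<in>(\<lambda>z. x - z) ` cube N. osc f y)" by (simp add: sum.reindex inj_on_def)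
  \<comment> \<open>The two index sets differ only at sites where either the oscillation of f or the
    indicator vanishes.\<close>
  also have "\<dots> = (\<Sum>y\<in>cube m. indicator (cube N) (x - y) * osc f y)"
  proof (rule sum.mono_neutral_cong)
    show "osc f y = 0" if "y \<in> (\<lambda>z. x - z) ` cube N - cube m" for y using that osc_eq_0[OF assms] by auto
    show "indicator (cube N) (x - y) * osc f y = 0" if "y \<in> cube m - (\<lambda>z. x - z) ` cube N" for y
    proof -
      have "y = x - (x - y)" by simp
      with that have "x - y \<notin> cube N" by blast
      then show ?thesis by simp
    qed
  qed auto
  finally show ?thesis .
qed

text \<open>The source of the gain: the squared norm grows like the volume and not like its square,
  because each column of the indicator kernel has at most that many ones.\<close>

lemma sum_osc_block_sum_sq_le:
  fixes f :: "('d::finite) config \<Rightarrow> real"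
  assumes f: "depends_on (cube m) f" and "(\<Sum>y\<in>cube m. osc f y) \<le> 1"
  shows "(\<Sum>x\<in>cube (m + N). (osc (block_sum N f) x)\<^sup>2) \<le> card (cube N :: 'd site set)"
proof -
  let ?w = "\<lambda>x y. indicator (cube N) (x - y) :: real"
  have o: "0 \<le> osc f y" for y by (rule osc_nonneg[OF bounded_depends_on[OF finite_cube f]])
  have "(\<Sum>x\<in>T. (?w x y)\<^sup>2) \<le> card (cube N :: 'd site set)" if T: "finite T" for T and y :: "'d site"
  proof -
    have "(?w x y)\<^sup>2 = ?w x y" for x by (simp add: indicator_def)
    then have "(\<Sum>x\<in>T. (?w x y)\<^sup>2) = (\<Sum>x\<in>(\<lambda>x. x - y) ` T. indicator (cube N) x)"
      by (simp add: sum.reindex inj_on_def)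
    also have "\<dots> = real (card ((\<lambda>x. x - y) ` T \<inter> cube N))"
      using T by (simp add: indicator_def sum_of_bool_eq)
    also have "\<dots> \<le> card (cube N :: 'd site set)" by (simp add: card_mono)
    finally show ?thesis .
  qed
  then have *: "(\<Sum>x\<in>cube (m + N). (\<Sum>y\<in>cube m. ?w x y * osc f y)\<^sup>2)
      \<le> card (cube N :: 'd site set) * (\<Sum>y\<in>cube m. osc f y)\<^sup>2"
    using o by (intro sum_kernel_sq_le_l1) auto
  have "(\<Sum>x\<in>cube (m + N). (osc (block_sum N f) x)\<^sup>2) \<le> (\<Sum>x\<in>cube (m + N). (\<Sum>y\<in>cube m. ?w x y * osc f y)\<^sup>2)"
    using osc_block_sum_le[OF f] osc_nonneg[OF bounded_depends_on[OF finite_cube depends_on_block_sum[OF f]]]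
    by (intro sum_mono power_mono)
  also note *
  also have "card (cube N :: 'd site set) * (\<Sum>y\<in>cube m. osc f y)\<^sup>2 \<le> real (card (cube N :: 'd site set)) * 1"
    using o assms(2) by (intro mult_left_mono power_le_one sum_nonneg) auto
  finally show ?thesis by simp
qed

lemma integral_block_sum:
  fixes f :: "('d::finite) config \<Rightarrow> real"
  assumes \<kappa>: "probability_on_configs \<kappa>" "translation_invariant \<kappa>" and f: "depends_on (cube m) f"
  shows "(\<integral>\<sigma>. block_sum N f \<sigma> \<partial>\<kappa>) = card (cube N :: 'd site set) * (\<integral>\<sigma>. f \<sigma> \<partial>\<kappa>)"
proof -
  have "depends_on ((\<lambda>y. y + z) ` cube m) (\<lambda>\<sigma>. f (translate z \<sigma>))" for z
    unfolding depends_on_def by (intro allI impI depends_onD[OF f]) (auto simp: translate_def)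
  then have "integrable \<kappa> (\<lambda>\<sigma>. f (translate z \<sigma>))" for z
    by (intro depends_on_integrable[OF \<kappa>(1), of "(\<lambda>y. y + z) ` cube m"]) auto
  then show ?thesis
    unfolding block_sum_def
    using integral_translate[OF \<kappa> depends_on_borel_measurable[OF finite_cube f]] by simp
qed

text \<open>Enlarging the cube by a fixed width is negligible relative to its volume: the ratio is
  the d-th power of a ratio of side lengths.\<close>

lemma card_cube_ratio_tendsto:
  "(\<lambda>N. real (card (cube (N + j) :: ('d::finite) site set)) / real (card (cube N :: 'd site set))) \<longlonglongrightarrow> 1"
proof -
  have "(\<lambda>N. real (2 * (N + j) + 1) / real (2 * N + 1)) \<longlonglongrightarrow> 1" by real_asymp
  from tendsto_power[OF this, of "CARD('d)"] show ?thesis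
    by (simp add: card_cube power_divide)
qed

section \<open>Approximation of continuous functions by local ones\<close>

text \<open>Freezes the spins outside the cube at \<open>+1\<close>.\<close>

definition truncate_config :: "nat \<Rightarrow> ('d::finite) config \<Rightarrow> 'd config" where
  "truncate_config n \<sigma> = (\<lambda>x. x \<in> cube n \<longrightarrow> \<sigma> x)"

lemma depends_on_truncate: "depends_on (cube n) (\<lambda>\<sigma>. f (truncate_config n \<sigma>))"
  unfolding depends_on_def
proof (intro allI impI)
  fix \<sigma> \<tau> :: "'a config" assume "\<forall>x\<in>cube n. \<sigma> x = \<tau> x"
  then have "truncate_config n \<sigma> = truncate_config n \<tau>" by (auto simp: truncate_config_def)
  then show "f (truncate_config n \<sigma>) = f (truncate_config n \<tau>)" by simp
qed

text \<open>Convergence in the product topology is coordinatewise, and each coordinate is eventually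
  unchanged.\<close>

lemma tendsto_truncate_config: "(\<lambda>n. truncate_config n \<sigma>) \<longlonglongrightarrow> \<sigma>"
proof -
  have "\<forall>\<^sub>F n in sequentially. truncate_config n \<sigma> x = \<sigma> x" for x :: "'a site"
  proof (rule eventually_sequentiallyI)
    \<comment> \<open>The sum of the absolute coordinates dominates each of them, so it is a cube
      size from which x is included.\<close>
    fix n assume n: "nat (\<Sum>i\<in>UNIV. \<bar>x $ i\<bar>) \<le> n"
    have "\<bar>x $ i\<bar> \<le> (\<Sum>i\<in>UNIV. \<bar>x $ i\<bar>)" for i by (rule member_le_sum) auto
    moreover have "(\<Sum>i\<in>UNIV. \<bar>x $ i\<bar>) \<le> int n" using n by (simp add: nat_le_iff)
    ultimately have "\<bar>x $ i\<bar> \<le> int n" for i using order_trans by blast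
    then have "x \<in> cube n" by (simp add: cube_def abs_le_iff) (smt (verit))
    then show "truncate_config n \<sigma> x = \<sigma> x" by (simp add: truncate_config_def)
  qed
  then have "(\<lambda>n. truncate_config n \<sigma> x) \<longlonglongrightarrow> \<sigma> x" for x by (rule tendsto_eventually)
  then have "limitin (product_topology (\<lambda>_. euclidean) UNIV) (\<lambda>n. truncate_config n \<sigma>) \<sigma> sequentially"
    by (simp add: limitin_componentwise)
  then show ?thesis by (simp add: euclidean_product_topology)
qed

text \<open>The configuration space is compact by Tychonoff's theorem.\<close>

lemma bounded_continuous_config:
  fixes f :: "('d::finite) config \<Rightarrow> real"
  assumes "continuous_on UNIV f"
  shows "bounded (range f)"
proof -
  have "compact_space (euclidean :: bool topology)" by (simp add: compact_space_def finite_imp_compact)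
  then have "compact_space (product_topology (\<lambda>_ :: 'd site. euclidean :: bool topology) UNIV)"
    by (simp add: compact_space_product_topology)
  then have "compact (UNIV :: 'd config set)" by (simp add: euclidean_product_topology compact_space_def)
  then show ?thesis using compact_continuous_image[OF assms] compact_imp_bounded by blast
qed

text \<open>Inside the cube flipping commutes with truncation; outside it truncation erases the
  flip.\<close>

lemma osc_truncate_le:
  assumes b: "bounded (range f)"
  shows "osc (\<lambda>\<sigma>. f (truncate_config n \<sigma>)) x \<le> osc f x"
proof (rule osc_le)
  fix \<sigma>
  show "f (truncate_config n (flip x \<sigma>)) - f (truncate_config n \<sigma>) \<le> osc f x"
  proof (cases "x \<in> cube n")
    case True
    then have "truncate_config n (flip x \<sigma>) = flip x (truncate_config n \<sigma>)"
      by (auto simp: truncate_config_def flip_def)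
    then show ?thesis using le_osc[OF b] by simp
  next
    case False
    then have "truncate_config n (flip x \<sigma>) = truncate_config n \<sigma>"
      by (auto simp: truncate_config_def flip_def)
    then show ?thesis using osc_nonneg[OF b] by simp
  qed
qed

lemma integral_truncate_tendsto:
  fixes f :: "('d::finite) config \<Rightarrow> real"
  assumes \<kappa>: "probability_on_configs \<kappa>" and f: "continuous_on UNIV f"
  shows "(\<lambda>n. \<integral>\<sigma>. f (truncate_config n \<sigma>) \<partial>\<kappa>) \<longlonglongrightarrow> (\<integral>\<sigma>. f \<sigma> \<partial>\<kappa>)"
proof -
  interpret prob_space \<kappa> using \<kappa> by (rule probability_on_configsD)
  obtain B where B: "\<And>\<sigma>. \<bar>f \<sigma>\<bar> \<le> B"
    using bounded_continuous_config[OF f] unfolding bounded_iff by auto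
  have m: "(\<lambda>\<sigma>. f (truncate_config n \<sigma>)) \<in> borel_measurable \<kappa>" for n
    by (intro borel_measurable_integrable depends_on_integrable[OF \<kappa> finite_cube depends_on_truncate])
  have "f \<in> borel_measurable \<kappa>"
    using borel_measurable_continuous_onI[OF f] probability_on_configsD(2)[OF \<kappa>]
    by (simp cong: measurable_cong_sets)
  moreover have "(\<lambda>n. f (truncate_config n \<sigma>)) \<longlonglongrightarrow> f \<sigma>" for \<sigma>
    using continuous_on_tendsto_compose[OF f tendsto_truncate_config] by simp
  ultimately show ?thesis using m B
    by (intro integral_dominated_convergence[where w = "\<lambda>_. B"]) auto
qed

section \<open>Bounds and convergence in the infinite-volume distance\<close>

context gcb_pca
begin

text \<open>Transport for the block sum bounds |C_N| \<Delta> by the square root of a constant times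
  |C_{N+j}| |C_N|. After squaring and dividing, only the volume ratio is left, which tends to
  1.\<close>

lemma dbar_local:
  assumes \<nu>: "probability_on_configs \<nu>" "translation_invariant \<nu>" and f: "depends_on (cube m) f"
    and A: "(lp_norm 1 (\<psi> k))\<^sup>2 = ereal A" "0 \<le> A" and osc: "(\<Sum>y\<in>cube m. osc f y) \<le> 1"
  shows "(\<integral>\<sigma>. f \<sigma> \<partial>(pca_step r ^^ k) \<nu>) - (\<integral>\<sigma>. f \<sigma> \<partial>\<mu>) \<le> sqrt (2 * C * \<rho> * A)"
proof -
  let ?c = "\<lambda>N. real (card (cube N :: 'd site set))"
  define \<Delta> where "\<Delta> = (\<integral>\<sigma>. f \<sigma> \<partial>(pca_step r ^^ k) \<nu>) - (\<integral>\<sigma>. f \<sigma> \<partial>\<mu>)"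
  \<comment> \<open>The total widening, from the support of f and from k steps of propagation, is
    independent of N.\<close>
  define j where "j = m + a * k"
  have c: "0 < ?c N" for N by (simp add: card_cube)
  show ?thesis
  proof (cases "\<Delta> \<le> 0")
    case True
    have "0 \<le> sqrt (2 * C * \<rho> * A)" using C \<rho> A by simp
    with True show ?thesis unfolding \<Delta>_def by linarith
  next
    case False
    have "\<Delta>\<^sup>2 \<le> 2 * C * \<rho> * A * (?c (N + j) / ?c N)" for N
    proof -
      have "?c N * \<Delta> = (\<integral>\<sigma>. block_sum N f \<sigma> \<partial>(pca_step r ^^ k) \<nu>) - (\<integral>\<sigma>. block_sum N f \<sigma> \<partial>\<mu>)"
        unfolding \<Delta>_def right_diff_distrib
        using integral_block_sum[OF probability_on_configs_pca_iterate[OF pca \<nu>(1)]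
            translation_invariant_pca_iterate[OF pca \<nu>] f]
          integral_block_sum[OF \<mu> ti f] by simp
      also have "\<dots> \<le> sqrt (2 * C * local_entropy (cube (m + N + a * k)) \<nu> \<mu> * (A * ?c N))"
        by (rule transport_l1_l2[OF \<nu>(1) depends_on_block_sum[OF f] A(1) sum_osc_block_sum_sq_le[OF f osc]])
      also have "\<dots> \<le> sqrt (2 * C * (\<rho> * ?c (m + N + a * k)) * (A * ?c N))"
        using C A c[of N] entropy_bounds(2)[OF \<nu>(1)]
        by (intro real_sqrt_le_mono mult_right_mono mult_left_mono) auto
      \<comment> \<open>Squaring preserves the inequality because \<Delta> is positive in this
        case.\<close>
      finally have "(?c N * \<Delta>)\<^sup>2 \<le> (sqrt (2 * C * (\<rho> * ?c (m + N + a * k)) * (A * ?c N)))\<^sup>2"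
        using False c[of N] by (intro power_mono) auto
      also have "\<dots> = 2 * C * (\<rho> * ?c (N + j)) * (A * ?c N)"
        using C \<rho> A c by (simp add: j_def ac_simps)
      finally show ?thesis using c[of N] by (simp add: field_simps power2_eq_square)
    qed
    moreover have "(\<lambda>N. 2 * C * \<rho> * A * (?c (N + j) / ?c N)) \<longlonglongrightarrow> 2 * C * \<rho> * A * 1"
      by (intro tendsto_mult_left card_cube_ratio_tendsto)
    ultimately have "\<Delta>\<^sup>2 \<le> 2 * C * \<rho> * A * 1" by (intro LIMSEQ_le_const) auto
    then show ?thesis unfolding \<Delta>_def by (intro real_le_rsqrt) simp
  qed
qed

text \<open>Truncation does not increase oscillations, so the local bound holds uniformly along the
  truncations; dominated convergence carries it to f.\<close>

lemma dbar_continuous: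
  assumes \<nu>: "probability_on_configs \<nu>" "translation_invariant \<nu>"
    and A: "(lp_norm 1 (\<psi> k))\<^sup>2 = ereal A" "0 \<le> A"
    and f: "continuous_on UNIV f" "lp_norm 1 (osc f) \<le> 1"
  shows "(\<integral>\<sigma>. f \<sigma> \<partial>(pca_step r ^^ k) \<nu>) - (\<integral>\<sigma>. f \<sigma> \<partial>\<mu>) \<le> sqrt (2 * C * \<rho> * A)"
proof -
  note b = bounded_continuous_config[OF f(1)]
  let ?f = "\<lambda>n \<sigma>. f (truncate_config n \<sigma>)"
  have "(\<Sum>y\<in>cube n. osc (?f n) y) \<le> 1" for n
  proof -
    have "(\<Sum>y\<in>cube n. osc (?f n) y) \<le> (\<Sum>y\<in>cube n. osc f y)" by (intro sum_mono osc_truncate_le b)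
    also have "\<dots> \<le> 1" by (rule lp_norm_le_1_sum(1)[OF finite_cube osc_nonneg[OF b] f(2)])
    finally show ?thesis .
  qed
  from dbar_local[OF \<nu> depends_on_truncate A this]
  have "(\<integral>\<sigma>. ?f n \<sigma> \<partial>(pca_step r ^^ k) \<nu>) - (\<integral>\<sigma>. ?f n \<sigma> \<partial>\<mu>) \<le> sqrt (2 * C * \<rho> * A)" for n .
  moreover have "(\<lambda>n. (\<integral>\<sigma>. ?f n \<sigma> \<partial>(pca_step r ^^ k) \<nu>) - (\<integral>\<sigma>. ?f n \<sigma> \<partial>\<mu>))
      \<longlonglongrightarrow> (\<integral>\<sigma>. f \<sigma> \<partial>(pca_step r ^^ k) \<nu>) - (\<integral>\<sigma>. f \<sigma> \<partial>\<mu>)"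
    by (intro tendsto_diff integral_truncate_tendsto f \<mu> probability_on_configs_pca_iterate pca \<nu>)
  ultimately show ?thesis by (intro LIMSEQ_le_const2) auto
qed

lemma dbar_iterate_le_real:
  assumes "probability_on_configs \<nu>" "translation_invariant \<nu>" "(lp_norm 1 (\<psi> k))\<^sup>2 = ereal A" "0 \<le> A"
  shows "dbar ((pca_step r ^^ k) \<nu>) \<mu> \<le> ereal (sqrt (2 * C * \<rho> * A))"
  unfolding dbar_def
proof (intro SUP_least)
  fix f :: "'d config \<Rightarrow> real" assume "f \<in> {f. continuous_on UNIV f \<and> lp_norm 1 (osc f) \<le> 1}"
  \<comment> \<open>The integrals in \<open>dbar\<close> are subtracted in the opposite order, so
    the bound is applied to the negated function.\<close>
  then have "continuous_on UNIV (\<lambda>\<sigma>. - f \<sigma>)" "lp_norm 1 (osc (\<lambda>\<sigma>. - f \<sigma>)) \<le> 1"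
    by (auto simp: osc_uminus intro: continuous_on_minus)
  from dbar_continuous[OF assms this]
  show "ereal ((\<integral>\<sigma>. f \<sigma> \<partial>\<mu>) - (\<integral>\<sigma>. f \<sigma> \<partial>(pca_step r ^^ k) \<nu>)) \<le> ereal (sqrt (2 * C * \<rho> * A))"
    by simp
qed

lemma dbar_iterate_le:
  assumes "probability_on_configs \<nu>" "translation_invariant \<nu>"
  shows "(dbar ((pca_step r ^^ k) \<nu>) \<mu>)\<^sup>2 \<le> ereal (2 * C * \<rho>) * (lp_norm 1 (\<psi> k))\<^sup>2"
  using C \<rho> dbar_iterate_le_real[OF assms]
  by (intro square_le_times_norm dbar_nonneg lp_norm_cases) auto

lemma dbar_iterate_tendsto:
  assumes \<nu>: "probability_on_configs \<nu>" "translation_invariant \<nu>"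
    and lim: "(\<lambda>k. lp_norm 1 (\<psi> k)) \<longlonglongrightarrow> 0"
  shows "(\<lambda>k. dbar ((pca_step r ^^ k) \<nu>) \<mu>) \<longlonglongrightarrow> 0"
proof (rule tendsto_sandwich)
  show "\<forall>\<^sub>F k in sequentially. 0 \<le> dbar ((pca_step r ^^ k) \<nu>) \<mu>" by (simp add: dbar_nonneg)
  \<comment> \<open>Any finite threshold would do: it makes the norm a real number, so that the
    square root of its square can be taken.\<close>
  have "\<forall>\<^sub>F k in sequentially. lp_norm 1 (\<psi> k) < 1" using order_tendstoD(2)[OF lim, of 1] by simp
  then show "\<forall>\<^sub>F k in sequentially. dbar ((pca_step r ^^ k) \<nu>) \<mu> \<le> ereal (sqrt (2 * C * \<rho>)) * lp_norm 1 (\<psi> k)"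
  proof eventually_elim
    case (elim k)
    then have s: "\<psi> k summable_on UNIV"
      using lp_norm_1_infinite[of "\<psi> k"] \<psi>_nonneg by fastforce
    define B where "B = (\<Sum>\<^sub>\<infinity>x. \<psi> k x)"
    have "0 \<le> B" unfolding B_def by (intro infsum_nonneg \<psi>_nonneg)
    moreover have n: "lp_norm 1 (\<psi> k) = ereal B" using lp_norm_1[of "\<psi> k"] s \<psi>_nonneg by (simp add: B_def)
    ultimately show ?case
      using dbar_iterate_le_real[OF \<nu>, of k "B\<^sup>2"] by (simp add: real_sqrt_mult)
  qed
  show "(\<lambda>k. ereal (sqrt (2 * C * \<rho>)) * lp_norm 1 (\<psi> k)) \<longlonglongrightarrow> 0"
    using tendsto_mult_ereal[OF tendsto_const lim, of "ereal (sqrt (2 * C * \<rho>))"] by simp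
qed simp

end

theorem theorem3p3:
  fixes r :: "('d::finite) site set \<Rightarrow> real"
    and \<psi> :: "nat \<Rightarrow> 'd site \<Rightarrow> real"
    and a :: nat
    and \<mu> :: "'d config measure"
    and C \<rho> :: real
  assumes "is_pca r"
    and "contraction_speed r \<psi>"
    and "local_with_speed r a"
    and "probability_on_configs \<mu>"
    and "stationary r \<mu>"
    and "translation_invariant \<mu>"
    and "C > 0"
    and "GCB C \<mu>"
    and "\<rho> > 0"
    and "finite_energy \<rho> \<mu>"
  shows "(\<forall>\<nu>. probability_on_configs \<nu> \<longrightarrow>
           (\<forall>n k.
              (D_inf (cube n) ((pca_step r ^^ k) \<nu>) \<mu>)\<^sup>2
                \<le> ereal (2 * C) * rel_entropy (cube (n + a * k)) \<nu> \<mu> * (lp_norm 2 (\<psi> k))\<^sup>2 \<and>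
              (D_two (cube n) ((pca_step r ^^ k) \<nu>) \<mu>)\<^sup>2
                \<le> ereal (2 * C) * rel_entropy (cube (n + a * k)) \<nu> \<mu> * (lp_norm 1 (\<psi> k))\<^sup>2 \<and>
              (D_inf (cube n) ((pca_step r ^^ k) \<nu>) \<mu>)\<^sup>2
                \<le> ereal (2 * C * \<rho> * real (card (cube (n + a * k) :: 'd site set)))
                    * (lp_norm 2 (\<psi> k))\<^sup>2)) \<and>
         (\<forall>\<nu>. probability_on_configs \<nu> \<and> translation_invariant \<nu> \<longrightarrow>
           (\<forall>k. (dbar ((pca_step r ^^ k) \<nu>) \<mu>)\<^sup>2
                  \<le> ereal (2 * C * \<rho>) * (lp_norm 1 (\<psi> k))\<^sup>2) \<and>
           ((\<lambda>k. lp_norm 1 (\<psi> k)) \<longlonglongrightarrow> 0 \<longrightarrow>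
              (\<lambda>k. dbar ((pca_step r ^^ k) \<nu>) \<mu>) \<longlonglongrightarrow> 0))"
proof -
  interpret gcb_pca r \<psi> a \<mu> C \<rho> by standard (fact assms)+
  have ent: "ereal (2 * C) * rel_entropy (cube n) \<nu> \<mu> = ereal (2 * C * local_entropy (cube n) \<nu> \<mu>)"
    if "probability_on_configs \<nu>" for \<nu> n
    using rel_entropy_finite_energy[OF \<mu> fe that finite_cube] by simp
  \<comment> \<open>Turns the first entropy bound into the volume bound. N may be infinite, which is
    harmless since its square is nonnegative.\<close>
  have vol: "ereal (2 * C * local_entropy (cube m) \<nu> \<mu>) * N\<^sup>2 \<le> ereal (2 * C * \<rho> * real (card (cube m :: 'd site set))) * N\<^sup>2"
    if "probability_on_configs \<nu>" for \<nu> m and N :: ereal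
  proof (rule ereal_mult_right_mono)
    show "ereal (2 * C * local_entropy (cube m) \<nu> \<mu>) \<le> ereal (2 * C * \<rho> * real (card (cube m :: 'd site set)))"
      using entropy_bounds(2)[OF that, of m] C by (simp add: mult.assoc mult_left_mono)
    show "0 \<le> N\<^sup>2" by (cases N) (simp_all add: power2_eq_square)
  qed
  show ?thesis
  proof (intro conjI allI impI)
    fix \<nu> :: "'d config measure" and n k assume \<nu>: "probability_on_configs \<nu>"
    show "(D_inf (cube n) ((pca_step r ^^ k) \<nu>) \<mu>)\<^sup>2
        \<le> ereal (2 * C) * rel_entropy (cube (n + a * k)) \<nu> \<mu> * (lp_norm 2 (\<psi> k))\<^sup>2"
      unfolding ent[OF \<nu>] by (rule D_inf_iterate_le[OF \<nu>])
    show "(D_two (cube n) ((pca_step r ^^ k) \<nu>) \<mu>)\<^sup>2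
        \<le> ereal (2 * C) * rel_entropy (cube (n + a * k)) \<nu> \<mu> * (lp_norm 1 (\<psi> k))\<^sup>2"
      unfolding ent[OF \<nu>] by (rule D_two_iterate_le[OF \<nu>])
    show "(D_inf (cube n) ((pca_step r ^^ k) \<nu>) \<mu>)\<^sup>2
        \<le> ereal (2 * C * \<rho> * real (card (cube (n + a * k) :: 'd site set))) * (lp_norm 2 (\<psi> k))\<^sup>2"
      by (rule order_trans[OF D_inf_iterate_le[OF \<nu>] vol[OF \<nu>]])
  next
    fix \<nu> :: "'d config measure" assume \<nu>: "probability_on_configs \<nu> \<and> translation_invariant \<nu>"
    show "(dbar ((pca_step r ^^ k) \<nu>) \<mu>)\<^sup>2 \<le> ereal (2 * C * \<rho>) * (lp_norm 1 (\<psi> k))\<^sup>2" for k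
      using \<nu> by (intro dbar_iterate_le) auto
    show "(\<lambda>k. dbar ((pca_step r ^^ k) \<nu>) \<mu>) \<longlonglongrightarrow> 0" if "(\<lambda>k. lp_norm 1 (\<psi> k)) \<longlonglongrightarrow> 0"
      using \<nu> that by (intro dbar_iterate_tendsto) auto
  qed
qed

end
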